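(* Assume ${\rm MA}(\sigma\text{-centered})$ and let $\kappa=\mathfrak c$. Then there is a $\mathrm{Fn}(\omega,2)$-indestructible mad family $\mathcal F$ on $T$ of size $\kappa$ such that $V^{\mathrm{Fn}(\omega,2)}\models$ "$\mathcal F$ is $\kappa$-almost decided on $T$".
   Context: $T={}^{\omega>}2$, $\mathfrak c=2^{\aleph_0}$. Almost disjoint = finite intersection; a mad family on $T$ is a maximal pairwise almost disjoint family of infinite subsets of $T$ with union $T$. A mad family is $\mathbb P$-indestructible if it remains mad in $[T]^{\aleph_0}$ in the generic extension $V^{\mathbb P}$. For $\mathcal B\subseteq[T]^{\aleph_0}$, $\mathcal B^\perp=\{Y\in[T]^{\aleph_0}:|X\cap Y|<\aleph_0\ \forall X\in\mathcal B\}$; $\mathcal I(\mathcal G)$ is the ideal generated by $\mathcal G\cup[T]^{<\omega}$. $\mathcal B\subseteq\mathcal F$ almost decides $\mathcal F$ if $\mathcal B^\perp=\mathcal I(\mathcal F\setminus\mathcal B)$ (as families of infinite subsets of $T$); $\mathcal F$ is $\kappa$-almost decided if every $\mathcal B\in[\mathcal F]^\kappa$ almost decides $\mathcal F$. $\mathrm{Fn}(\omega,2)$ is Cohen forcing; ${\rm MA}(\sigma\text{-centered})$ is Martin's Axiom for $\sigma$-centered posets. *)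

theory Defs
  imports "HOL-Library.Equipollence"
begin

text \<open>A poset is given by its order relation \<open>r\<close>, with \<open>(q, p) \<in> r\<close> meaning \<open>q \<le> p\<close>
  (\<open>q\<close> is the stronger condition); its carrier is \<open>Field r\<close>.\<close>

type_synonym node = "bool list" \<comment> \<open>the type of all elements of \<open>T\<close>, so that \<open>T = UNIV\<close>\<close>

abbreviation continuum :: "nat set set"
  where "continuum \<equiv> UNIV"


section \<open>Martin's Axiom for sigma-centered posets\<close>

definition centered :: "'u rel \<Rightarrow> 'u set \<Rightarrow> bool"
  where "centered r C \<longleftrightarrow> C \<subseteq> Field r \<and>
    (\<forall>A. finite A \<and> A \<subseteq> C \<longrightarrow> (\<exists>q\<in>Field r. \<forall>p\<in>A. (q, p) \<in> r))"

definition sigma_centered :: "'u rel \<Rightarrow> bool"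
  where "sigma_centered r \<longleftrightarrow>
    (\<exists>C :: nat \<Rightarrow> 'u set. Field r = (\<Union>n. C n) \<and> (\<forall>n. centered r (C n)))"

definition dense_in :: "'u rel \<Rightarrow> 'u set \<Rightarrow> bool"
  where "dense_in r D \<longleftrightarrow> D \<subseteq> Field r \<and> (\<forall>p\<in>Field r. \<exists>q\<in>D. (q, p) \<in> r)"

definition filter_in :: "'u rel \<Rightarrow> 'u set \<Rightarrow> bool"
  where "filter_in r G \<longleftrightarrow> G \<subseteq> Field r \<and> G \<noteq> {} \<and>
    (\<forall>p\<in>G. \<forall>q. (p, q) \<in> r \<longrightarrow> q \<in> G) \<and>
    (\<forall>p\<in>G. \<forall>q\<in>G. \<exists>s\<in>G. (s, p) \<in> r \<and> (s, q) \<in> r)"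

text \<open>The axiom for all posets whose conditions are taken from the type \<open>'u\<close>.  A formula cannot
  quantify over types; every \<open>'u\<close> with at least continuum many elements gives the full axiom, since
  \<open>MA\<close> reduces to posets of size less than the continuum by a Loewenheim-Skolem
  argument.\<close>

definition MA_sigma_centered :: "'u itself \<Rightarrow> bool"
  where "MA_sigma_centered _ \<longleftrightarrow>
    (\<forall>r :: 'u rel. partial_order_on (Field r) r \<and> Field r \<noteq> {} \<and> sigma_centered r \<longrightarrow>
      (\<forall>\<D>. \<D> \<prec> continuum \<and> (\<forall>D\<in>\<D>. dense_in r D) \<longrightarrow>
        (\<exists>G. filter_in r G \<and> (\<forall>D\<in>\<D>. G \<inter> D \<noteq> {}))))"


section \<open>Mad families\<close>

definition ad_family :: "'a set set \<Rightarrow> bool"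
  where "ad_family F \<longleftrightarrow> (\<forall>X\<in>F. infinite X) \<and> (\<forall>X\<in>F. \<forall>Y\<in>F. X \<noteq> Y \<longrightarrow> finite (X \<inter> Y))"

definition mad_family :: "'a set set \<Rightarrow> bool"
  where "mad_family F \<longleftrightarrow> ad_family F \<and> \<Union>F = UNIV \<and>
    (\<forall>G. ad_family G \<and> F \<subseteq> G \<longrightarrow> G = F)"


section \<open>Forcing\<close>

text \<open>A sentence of the forcing language is identified with the set of conditions forcing it,
  i.e. \<open>p \<in> \<phi>\<close> stands for \<open>p \<tturnstile> \<phi>\<close>, and the connectives are the recursive clauses defining the
  forcing relation.

  An element of a ground model set (a type \<open>'a\<close>) stands for its own check name.  Subsets of
  \<open>'a\<close> in the extension are named by the names all of whose elements are pairs \<open>(a, p)\<close> of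
  a check name and a condition: every subset of a ground model set in the extension has such a
  name, so these names are what a second-order quantifier over \<open>'a\<close> ranges over.  Pairs whose
  second component is not a condition have no effect.\<close>

type_synonym ('a, 'c) name = "('a \<times> 'c) set"

locale forcing =
  fixes r :: "'c rel"
begin

definition f_not :: "'c set \<Rightarrow> 'c set" (\<open>\<^bold>\<not> _\<close> [40] 40)
  where "(\<^bold>\<not> \<phi>) = {p \<in> Field r. \<forall>q. (q, p) \<in> r \<longrightarrow> q \<notin> \<phi>}"

definition f_and :: "'c set \<Rightarrow> 'c set \<Rightarrow> 'c set" (infixr \<open>\<^bold>\<and>\<close> 35)
  where "(\<phi> \<^bold>\<and> \<psi>) = \<phi> \<inter> \<psi>"

definition f_all :: "('x \<Rightarrow> 'c set) \<Rightarrow> 'c set" (binder \<open>\<^bold>\<forall>\<close> 10)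
  where "(\<^bold>\<forall>x. \<phi> x) = {p \<in> Field r. \<forall>x. p \<in> \<phi> x}"

definition f_or :: "'c set \<Rightarrow> 'c set \<Rightarrow> 'c set" (infixr \<open>\<^bold>\<or>\<close> 30)
  where "(\<phi> \<^bold>\<or> \<psi>) = (\<^bold>\<not> (\<^bold>\<not> \<phi> \<^bold>\<and> \<^bold>\<not> \<psi>))"

definition f_imp :: "'c set \<Rightarrow> 'c set \<Rightarrow> 'c set" (infixr \<open>\<^bold>\<longrightarrow>\<close> 25)
  where "(\<phi> \<^bold>\<longrightarrow> \<psi>) = (\<^bold>\<not> (\<phi> \<^bold>\<and> \<^bold>\<not> \<psi>))"

definition f_iff :: "'c set \<Rightarrow> 'c set \<Rightarrow> 'c set" (infixr \<open>\<^bold>\<longleftrightarrow>\<close> 25)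
  where "(\<phi> \<^bold>\<longleftrightarrow> \<psi>) = ((\<phi> \<^bold>\<longrightarrow> \<psi>) \<^bold>\<and> (\<psi> \<^bold>\<longrightarrow> \<phi>))"

definition f_ex :: "('x \<Rightarrow> 'c set) \<Rightarrow> 'c set" (binder \<open>\<^bold>\<exists>\<close> 10)
  where "(\<^bold>\<exists>x. \<phi> x) = (\<^bold>\<not> (\<^bold>\<forall>x. \<^bold>\<not> \<phi> x))"

text \<open>Equality of check names, and membership of a check name in a name.\<close>

definition f_id :: "'a \<Rightarrow> 'a \<Rightarrow> 'c set" (infix \<open>\<^bold>=\<close> 50)
  where "(a \<^bold>= b) = {p \<in> Field r. a = b}"

definition f_mem :: "'a \<Rightarrow> ('a, 'c) name \<Rightarrow> 'c set" (infix \<open>\<^bold>\<in>\<close> 50)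
  where "(a \<^bold>\<in> X) =
    {p \<in> Field r. \<forall>q. (q, p) \<in> r \<longrightarrow> (\<exists>s u. (s, q) \<in> r \<and> (a, u) \<in> X \<and> (s, u) \<in> r)}"

definition f_subset :: "('a, 'c) name \<Rightarrow> ('a, 'c) name \<Rightarrow> 'c set" (infix \<open>\<^bold>\<subseteq>\<close> 50)
  where "(X \<^bold>\<subseteq> Y) = (\<^bold>\<forall>a. a \<^bold>\<in> X \<^bold>\<longrightarrow> a \<^bold>\<in> Y)"

definition f_eq :: "('a, 'c) name \<Rightarrow> ('a, 'c) name \<Rightarrow> 'c set" (infix \<open>\<^bold>\<equiv>\<close> 50)
  where "(X \<^bold>\<equiv> Y) = (X \<^bold>\<subseteq> Y \<^bold>\<and> Y \<^bold>\<subseteq> X)"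

text \<open>All conditions replace the largest condition used in the textbook check name.\<close>

definition check :: "'a set \<Rightarrow> ('a, 'c) name"
  where "check A = A \<times> Field r"

text \<open>The canonical name of \<open>{a. \<phi> a}\<close>.\<close>

definition f_Collect :: "('a \<Rightarrow> 'c set) \<Rightarrow> ('a, 'c) name"
  where "f_Collect \<phi> = {(a, p). p \<in> \<phi> a}"

definition f_inter :: "('a, 'c) name \<Rightarrow> ('a, 'c) name \<Rightarrow> ('a, 'c) name" (infixl \<open>\<^bold>\<inter>\<close> 70)
  where "X \<^bold>\<inter> Y = f_Collect (\<lambda>a. a \<^bold>\<in> X \<^bold>\<and> a \<^bold>\<in> Y)"

definition f_diff :: "('a, 'c) name \<Rightarrow> ('a, 'c) name \<Rightarrow> ('a, 'c) name" (infixl \<open>\<^bold>-\<close> 65)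
  where "X \<^bold>- Y = f_Collect (\<lambda>a. a \<^bold>\<in> X \<^bold>\<and> \<^bold>\<not> a \<^bold>\<in> Y)"

definition f_eqpoll :: "('a, 'c) name \<Rightarrow> ('b, 'c) name \<Rightarrow> 'c set" (infix \<open>\<^bold>\<approx>\<close> 50)
  where "(X \<^bold>\<approx> Y) = (\<^bold>\<exists>R :: ('a \<times> 'b, 'c) name.
      (\<^bold>\<forall>x y. (x, y) \<^bold>\<in> R \<^bold>\<longrightarrow> x \<^bold>\<in> X \<^bold>\<and> y \<^bold>\<in> Y) \<^bold>\<and>
      (\<^bold>\<forall>x. x \<^bold>\<in> X \<^bold>\<longrightarrow> (\<^bold>\<exists>y. (x, y) \<^bold>\<in> R)) \<^bold>\<and>
      (\<^bold>\<forall>y. y \<^bold>\<in> Y \<^bold>\<longrightarrow> (\<^bold>\<exists>x. (x, y) \<^bold>\<in> R)) \<^bold>\<and>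
      (\<^bold>\<forall>x y y'. (x, y) \<^bold>\<in> R \<^bold>\<and> (x, y') \<^bold>\<in> R \<^bold>\<longrightarrow> y \<^bold>= y') \<^bold>\<and>
      (\<^bold>\<forall>x x' y. (x, y) \<^bold>\<in> R \<^bold>\<and> (x', y) \<^bold>\<in> R \<^bold>\<longrightarrow> x \<^bold>= x'))"

definition f_finite :: "('a, 'c) name \<Rightarrow> 'c set"
  where "f_finite X = (\<^bold>\<exists>n :: nat. X \<^bold>\<approx> check {..<n})"


subsection \<open>Mad families in the extension\<close>

text \<open>Names for families of subsets of \<open>'a\<close>; two names for subsets may denote the same set, so
  membership goes through forced equality.\<close>

definition f_fam_mem :: "('a, 'c) name \<Rightarrow> (('a, 'c) name, 'c) name \<Rightarrow> 'c set"
    (infix \<open>\<^bold>\<in>\<^bold>\<in>\<close> 50)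
  where "(Y \<^bold>\<in>\<^bold>\<in> \<G>) =
    {p \<in> Field r. \<forall>q. (q, p) \<in> r \<longrightarrow>
      (\<exists>s Z u. (s, q) \<in> r \<and> (Z, u) \<in> \<G> \<and> (s, u) \<in> r \<and> s \<in> (Y \<^bold>\<equiv> Z))}"

definition check_fam :: "'a set set \<Rightarrow> (('a, 'c) name, 'c) name"
  where "check_fam F = check (check ` F)"

definition f_ad_family :: "(('a, 'c) name, 'c) name \<Rightarrow> 'c set"
  where "f_ad_family \<G> =
    ((\<^bold>\<forall>X. X \<^bold>\<in>\<^bold>\<in> \<G> \<^bold>\<longrightarrow> \<^bold>\<not> f_finite X) \<^bold>\<and>
     (\<^bold>\<forall>X Y. X \<^bold>\<in>\<^bold>\<in> \<G> \<^bold>\<and> Y \<^bold>\<in>\<^bold>\<in> \<G> \<^bold>\<and> \<^bold>\<not> X \<^bold>\<equiv> Y \<^bold>\<longrightarrow> f_finite (X \<^bold>\<inter> Y)))"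

definition f_mad_family :: "(('a, 'c) name, 'c) name \<Rightarrow> 'c set"
  where "f_mad_family \<F> =
    (f_ad_family \<F> \<^bold>\<and>
     (\<^bold>\<forall>t. \<^bold>\<exists>X. X \<^bold>\<in>\<^bold>\<in> \<F> \<^bold>\<and> t \<^bold>\<in> X) \<^bold>\<and>
     (\<^bold>\<forall>\<G>. f_ad_family \<G> \<^bold>\<and> (\<^bold>\<forall>X. X \<^bold>\<in>\<^bold>\<in> \<F> \<^bold>\<longrightarrow> X \<^bold>\<in>\<^bold>\<in> \<G>) \<^bold>\<longrightarrow>
        (\<^bold>\<forall>X. X \<^bold>\<in>\<^bold>\<in> \<G> \<^bold>\<longleftrightarrow> X \<^bold>\<in>\<^bold>\<in> \<F>)))"


subsection \<open>Almost decided families in the extension\<close>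

text \<open>Here \<open>F\<close> is a family from the ground model, and the subfamilies \<open>\<B>\<close> of \<open>F\<close> in the
  extension are named as subsets of the ground model set \<open>F\<close>.\<close>

definition f_in_perp :: "('a, 'c) name \<Rightarrow> ('a set, 'c) name \<Rightarrow> 'c set"
  where "f_in_perp Y \<B> =
    ((\<^bold>\<not> f_finite Y) \<^bold>\<and> (\<^bold>\<forall>X. X \<^bold>\<in> \<B> \<^bold>\<longrightarrow> f_finite (check X \<^bold>\<inter> Y)))"

text \<open>\<open>Y\<close> lies in the ideal generated by \<open>\<G>\<close> and the finite sets.\<close>

definition f_in_ideal :: "('a, 'c) name \<Rightarrow> ('a set, 'c) name \<Rightarrow> 'c set"
  where "f_in_ideal Y \<G> =
    (\<^bold>\<exists>(\<H> :: ('a set, 'c) name) (E :: ('a, 'c) name).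
      f_finite \<H> \<^bold>\<and> \<H> \<^bold>\<subseteq> \<G> \<^bold>\<and> f_finite E \<^bold>\<and>
      (\<^bold>\<forall>t. t \<^bold>\<in> Y \<^bold>\<longrightarrow> (\<^bold>\<exists>X. X \<^bold>\<in> \<H> \<^bold>\<and> t \<^bold>\<in> check X) \<^bold>\<or> t \<^bold>\<in> E))"

definition f_almost_decides :: "('a set, 'c) name \<Rightarrow> 'a set set \<Rightarrow> 'c set"
  where "f_almost_decides \<B> F =
    (\<^bold>\<forall>Y :: ('a, 'c) name. \<^bold>\<not> f_finite Y \<^bold>\<longrightarrow> (f_in_perp Y \<B> \<^bold>\<longleftrightarrow> f_in_ideal Y (check F \<^bold>- \<B>)))"

text \<open>\<open>K\<close> is a ground model set of size \<open>\<kappa>\<close>.\<close>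

definition f_almost_decided :: "'k set \<Rightarrow> 'a set set \<Rightarrow> 'c set"
  where "f_almost_decided K F =
    (\<^bold>\<forall>\<B> :: ('a set, 'c) name. \<B> \<^bold>\<subseteq> check F \<^bold>\<and> \<B> \<^bold>\<approx> check K \<^bold>\<longrightarrow> f_almost_decides \<B> F)"


subsection \<open>Truth in every generic extension\<close>

definition forced :: "'c set \<Rightarrow> bool"
  where "forced \<phi> \<longleftrightarrow> (\<forall>p\<in>Field r. p \<in> \<phi>)"

definition indestructible :: "'a set set \<Rightarrow> bool"
  where "indestructible F \<longleftrightarrow> forced (f_mad_family (check_fam F))"

end


section \<open>Cohen forcing\<close>

definition Fn :: "'i set \<Rightarrow> 'j set \<Rightarrow> ('i \<rightharpoonup> 'j) rel"
  where "Fn I J = {(q, p). finite (dom q) \<and> dom q \<subseteq> I \<and> ran q \<subseteq> J \<and> p \<subseteq>\<^sub>m q}"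

abbreviation Cohen :: "(nat \<rightharpoonup> bool) rel"
  where "Cohen \<equiv> Fn UNIV UNIV"

end

theory Submission
  imports Defs
begin

text \<open>
  In the ground model, \<open>F\<close> is built by recursion along the continuum so that every set \<open>A\<close>
  outside the ideal generated by \<open>F\<close> has infinite intersection with all but fewer than continuum
  many members of \<open>F\<close>; \<open>MA\<close> provides the next member at each stage.

  For a Cohen name \<open>Y\<close> this is applied to the countably many sets \<open>poss Y p\<close> of those nodes that
  some extension of \<open>p\<close> forces into \<open>Y\<close>.  If \<open>\<B>\<close> has size continuum in the extension, then, as the
  forcing is countable, a condition puts into \<open>\<B>\<close> some \<open>X\<close> that is not exceptional for \<open>Y\<close>.  If \<open>Y\<close>
  is orthogonal to \<open>\<B>\<close>, some stronger \<open>p\<close> makes \<open>X \<inter> poss Y p\<close> finite, so \<open>poss Y p\<close>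
  is almost covered by finitely many members of \<open>F\<close>; those that lie in \<open>\<B>\<close> can be dropped from the
  cover.  Maximality in the extension is the case \<open>\<B> = F\<close> of the same argument.
\<close>

section \<open>Sets smaller than the continuum\<close>

text \<open>This turns strict comparison by injections into strict comparison of cardinal orders,
  where closure under sums and the size of initial segments are known.\<close>

lemma lesspoll_iff_card_of: "A \<prec> B \<longleftrightarrow> (card_of A, card_of B) \<in> ordLess"
proof -
  have "A \<lesssim> B \<longleftrightarrow> (card_of A, card_of B) \<in> ordLeq" for A :: "'a set" and B :: "'b set"
    unfolding lepoll_def card_of_ordLeq by auto
  then show ?thesis
    unfolding lesspoll_def eqpoll_iff_card_of_ordIso by (simp add: ordLeq_iff_ordLess_or_ordIso)
      (meson not_ordLess_ordIso)
qed

lemma infinite_continuum: "infinite continuum"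
  by (simp add: Finite_Set.finite_set)

lemma countable_lesspoll_continuum: "countable A \<Longrightarrow> A \<prec> continuum"
  using lesspoll_Pow_self[of "UNIV :: nat set"] lesspoll_trans1[of A "UNIV :: nat set" continuum]
  by (auto simp: countable_def lepoll_def)

lemma Un_lesspoll_continuum: "A \<prec> continuum \<Longrightarrow> B \<prec> continuum \<Longrightarrow> A \<union> B \<prec> continuum"
  unfolding lesspoll_iff_card_of
  by (rule card_of_Un_ordLess_infinite[OF infinite_continuum])

text \<open>Both factors embed in \<open>C\<close>, the disjoint sum of \<open>A\<close> with the
  naturals. Being infinite, \<open>C\<close> absorbs its own square, and it is still smaller than
  the continuum. The summand of naturals takes care of finite \<open>A\<close>.\<close>

lemma Times_countable_lesspoll_continuum:
  fixes A :: "'a set" and B :: "'b set"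
  assumes "A \<prec> continuum" "countable B"
  shows "A \<times> B \<prec> continuum"
proof -
  define C where "C = A <+> (UNIV :: nat set)"
  have "infinite C" by (simp add: C_def)
  have "C \<prec> continuum"
    unfolding lesspoll_iff_card_of C_def
    by (rule card_of_Plus_ordLess_infinite[OF infinite_continuum])
      (use assms countable_lesspoll_continuum[of "UNIV :: nat set"] in \<open>auto simp: lesspoll_iff_card_of\<close>)
  have "A \<lesssim> C" unfolding C_def by (auto simp: lepoll_def intro!: exI[of _ Inl])
  moreover have "B \<lesssim> C"
  proof -
    obtain f :: "'b \<Rightarrow> nat" where "inj_on f B" using assms(2) unfolding countable_def by blast
    then have "inj_on (Inr \<circ> f) B" by (simp add: comp_inj_on)
    moreover have "(Inr \<circ> f) ` B \<subseteq> C" unfolding C_def by auto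
    ultimately show ?thesis unfolding lepoll_def by blast
  qed
  ultimately have "A \<times> B \<lesssim> C \<times> C" by (rule times_lepoll_mono)
  also have "C \<times> C \<approx> C"
    using card_of_Times_same_infinite[OF \<open>infinite C\<close>] by (simp add: eqpoll_iff_card_of_ordIso)
  also note \<open>C \<prec> continuum\<close>
  finally show ?thesis .
qed

lemma eqpoll_lesspoll_ex_Diff:
  assumes "F \<approx> K" "S \<prec> K"
  obtains X where "X \<in> F - S"
proof -
  have "\<not> F \<subseteq> S"
  proof
    assume "F \<subseteq> S"
    from lesspoll_trans1[OF subset_imp_lepoll[OF this] assms(2)] assms(1) show False
      by (simp add: lesspoll_def)
  qed
  then show ?thesis using that by blast
qed

section \<open>An almost disjoint family from Martin's Axiom\<close>

text \<open>\<open>MA_sigma_centered\<close> speaks of orders on one fixed type. A poset with at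
  most continuum many conditions, on any type, is copied into that type along an injection, and the
  filter found there is pulled back.\<close>

lemma MA_sigma_centered_filter:
  fixes r :: "'v rel"
  assumes "continuum \<lesssim> (UNIV :: 'u set)" "MA_sigma_centered TYPE('u)"
    and "partial_order_on (Field r) r" "Field r \<noteq> {}" "sigma_centered r" "Field r \<lesssim> continuum"
    and "\<D> \<prec> continuum" "\<And>D. D \<in> \<D> \<Longrightarrow> dense_in r D"
  obtains G where "filter_in r G" "\<And>D. D \<in> \<D> \<Longrightarrow> G \<inter> D \<noteq> {}"
proof -
  have "Field r \<lesssim> (UNIV :: 'u set)" using assms(1,6) lepoll_trans by blast
  then obtain f :: "'v \<Rightarrow> 'u" where f: "inj_on f (Field r)" by (auto simp: lepoll_def)
  define r' where "r' = map_prod f f ` r"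
  have mem: "(f x, f y) \<in> r' \<longleftrightarrow> (x, y) \<in> r" if "x \<in> Field r" "y \<in> Field r" for x y
  proof
    assume "(f x, f y) \<in> r'"
    then obtain a b where ab: "(a, b) \<in> r" "f x = f a" "f y = f b" unfolding r'_def by auto
    moreover have "a \<in> Field r" "b \<in> Field r" using ab(1) by (auto intro: FieldI1 FieldI2)
    ultimately have "x = a" "y = b" using f that by (auto dest: inj_onD)
    then show "(x, y) \<in> r" using ab(1) by simp
  qed (auto simp: r'_def)
  have fwd: "(f x, f y) \<in> r'" if "(x, y) \<in> r" for x y
    using that unfolding r'_def by auto
  have Fr: "Field r' = f ` Field r"
    unfolding r'_def Field_def by force
  have po: "partial_order_on (Field r') r'"
    using assms(3) unfolding partial_order_on_def preorder_on_def
  proof (elim conjE, intro conjI)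
    assume "refl_on (Field r) r" then show "refl_on (Field r') r'"
      by (auto simp: refl_on_def Fr mem)
  next
    assume t: "trans r"
    show "trans r'"
    proof (rule transI)
      fix x y z assume "(x, y) \<in> r'" "(y, z) \<in> r'"
      moreover from this have "x \<in> Field r'" "y \<in> Field r'" "z \<in> Field r'"
        by (auto intro: FieldI1 FieldI2)
      ultimately show "(x, z) \<in> r'" using t by (auto simp: Fr mem dest: transD)
    qed
  next
    assume t: "antisym r"
    show "antisym r'"
    proof (rule antisymI)
      fix x y assume xy: "(x, y) \<in> r'" "(y, x) \<in> r'"
      then have "x \<in> Field r'" "y \<in> Field r'" by (auto simp: FieldI1 FieldI2)
      with xy t show "x = y" by (auto simp: Fr mem dest: antisymD)
    qed
  qed (auto simp: Field_def)
  obtain C :: "nat \<Rightarrow> 'v set" where C: "Field r = (\<Union>n. C n)" "\<And>n. centered r (C n)"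
    using assms(5) unfolding sigma_centered_def by blast
  have "centered r' (f ` C n)" for n
    unfolding centered_def
  proof (intro conjI allI impI)
    show "f ` C n \<subseteq> Field r'" using C(1) Fr by auto
    fix A assume "finite A \<and> A \<subseteq> f ` C n"
    then obtain B where B: "finite B" "B \<subseteq> C n" "A = f ` B"
      by (meson finite_subset_image)
    then obtain q where "q \<in> Field r" "\<forall>p\<in>B. (q, p) \<in> r"
      using C(2)[of n] unfolding centered_def by blast
    then show "\<exists>q\<in>Field r'. \<forall>p\<in>A. (q, p) \<in> r'"
      unfolding B(3) Fr using fwd by blast
  qed
  then have sc: "sigma_centered r'"
    unfolding sigma_centered_def Fr C(1) by (intro exI[of _ "\<lambda>n. f ` C n"]) auto
  have "(\<lambda>D. f ` D) ` \<D> \<prec> continuum"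
    using assms(7) image_lepoll lesspoll_trans1 by blast
  moreover have "\<forall>D\<in>(\<lambda>D. f ` D) ` \<D>. dense_in r' D"
  proof clarify
    fix D assume "D \<in> \<D>"
    then have "dense_in r D" by (rule assms(8))
    then show "dense_in r' (f ` D)"
      unfolding dense_in_def Fr using fwd by blast
  qed
  moreover have "Field r' \<noteq> {}" using assms(4) Fr by simp
  ultimately have "\<exists>G. filter_in r' G \<and> (\<forall>D\<in>(\<lambda>D. f ` D) ` \<D>. G \<inter> D \<noteq> {})"
    using po sc
    by (intro assms(2)[unfolded MA_sigma_centered_def, THEN spec, THEN mp, THEN spec, THEN mp] conjI)
  then obtain G where G: "filter_in r' G" "\<forall>D\<in>(\<lambda>D. f ` D) ` \<D>. G \<inter> D \<noteq> {}"
    by (elim exE conjE)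
  have sub: "G \<subseteq> Field r'" and "G \<noteq> {}"
    and up: "\<And>p q. p \<in> G \<Longrightarrow> (p, q) \<in> r' \<Longrightarrow> q \<in> G"
    and dir: "\<And>p q. p \<in> G \<Longrightarrow> q \<in> G \<Longrightarrow> \<exists>s\<in>G. (s, p) \<in> r' \<and> (s, q) \<in> r'"
    using G(1) unfolding filter_in_def by blast+
  define H where "H = {x \<in> Field r. f x \<in> G}"
  have GH: "G = f ` H" using sub unfolding H_def Fr by blast
  have "filter_in r H"
    unfolding filter_in_def
  proof (intro conjI ballI allI impI)
    show "H \<subseteq> Field r" unfolding H_def by blast
    show "H \<noteq> {}" using \<open>G \<noteq> {}\<close> unfolding GH by blast
    fix p assume p: "p \<in> H"
    {
      fix q assume pq: "(p, q) \<in> r"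
      then have "f q \<in> G" using p up fwd unfolding H_def by blast
      then show "q \<in> H" using FieldI2[OF pq] unfolding H_def by blast
    }
    fix q assume q: "q \<in> H"
    have "f p \<in> G" "f q \<in> G" using p q unfolding H_def by blast+
    from dir[OF this] obtain t where "t \<in> G" "(t, f p) \<in> r'" "(t, f q) \<in> r'" by blast
    moreover from this obtain s where "s \<in> H" "t = f s" unfolding GH by blast
    ultimately show "\<exists>s\<in>H. (s, p) \<in> r \<and> (s, q) \<in> r"
      using p q mem unfolding H_def by blast
  qed
  moreover have "H \<inter> D \<noteq> {}" if D: "D \<in> \<D>" for D
  proof -
    from G(2) D obtain x where "x \<in> H" "f x \<in> f ` D" unfolding GH by blast
    moreover have "D \<subseteq> Field r" using assms(8)[OF D] by (simp add: dense_in_def)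
    ultimately have "x \<in> D" using f unfolding H_def
      by (metis (mono_tags, lifting) inj_on_image_mem_iff mem_Collect_eq)
    then show ?thesis using \<open>x \<in> H\<close> by auto
  qed
  ultimately show ?thesis by (rule that)
qed

text \<open>The forcing consists of pairs \<open>(s, A)\<close>, where \<open>s\<close> is a finite part of the new set
  and \<open>A\<close> is a promise that no further element will lie in \<open>A\<close>.\<close>

lemma MA_almost_disjoint_meeting:
  fixes \<G> \<A> :: "'a :: countable set set"
  assumes MA: "continuum \<lesssim> (UNIV :: 'u set)" "MA_sigma_centered TYPE('u)"
    and "\<G> \<prec> continuum" "\<A> \<prec> continuum"
    and pos: "\<And>A H. A \<in> \<A> \<Longrightarrow> H \<subseteq> \<G> \<Longrightarrow> finite H \<Longrightarrow> infinite (A - \<Union>H)"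
  obtains X where "\<And>Y. Y \<in> \<G> \<Longrightarrow> finite (X \<inter> Y)" "\<And>A. A \<in> \<A> \<Longrightarrow> infinite (X \<inter> A)"
proof -
  define P where "P = {(s, \<Union>H) | s H. finite (s :: 'a set) \<and> finite H \<and> H \<subseteq> \<G>}"
  define r where "r = {((s', A'), (s, A)) | s' A' s A.
    (s', A') \<in> P \<and> (s, A) \<in> P \<and> s \<subseteq> s' \<and> A \<subseteq> A' \<and> (s' - s) \<inter> A = {}}"
  have refl: "(x, x) \<in> r" if "x \<in> P" for x using that unfolding r_def by (cases x) auto
  then have Fr: "Field r = P" unfolding Field_def r_def by fastforce
  have "trans r"
  proof (rule transI)
    fix x y z assume "(x, y) \<in> r" "(y, z) \<in> r"
    then show "(x, z) \<in> r" unfolding r_def by (cases x; cases y; cases z) auto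
  qed
  moreover have "antisym r" by (rule antisymI) (auto simp: r_def)
  moreover have "r \<subseteq> P \<times> P" unfolding r_def by auto
  ultimately have po: "partial_order_on (Field r) r"
    using refl unfolding partial_order_on_def preorder_on_def refl_on_def Fr by blast
  have "({}, {}) \<in> P" unfolding P_def by (auto intro!: exI[of _ "{}"])
  then have ne: "Field r \<noteq> {}" using Fr by auto
  have PUn: "(s, A \<union> B) \<in> P" if sA: "(s, A) \<in> P" and tB: "(t, B) \<in> P" for s t A B
  proof -
    from sA obtain H where "finite s" "finite H" "H \<subseteq> \<G>" "A = \<Union>H" unfolding P_def by auto
    moreover from tB obtain K where "finite K" "K \<subseteq> \<G>" "B = \<Union>K" unfolding P_def by auto
    ultimately show ?thesis unfolding P_def by (auto intro!: exI[of _ "H \<union> K"])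
  qed
  \<comment> \<open>Conditions with a common stem are compatible: keeping the stem and uniting the
    promises violates none of them.\<close>
  have lower: "\<exists>A. (s, A) \<in> P \<and> (\<forall>p\<in>Q. ((s, A), p) \<in> r)"
    if "finite Q" "Q \<subseteq> {p \<in> P. fst p = s}" "finite s" for s Q
    using that
  proof (induction Q)
    case empty
    then show ?case unfolding P_def by (auto intro!: exI[of _ "{}"])
  next
    case (insert p Q)
    then obtain A B where A: "(s, A) \<in> P" "\<forall>p\<in>Q. ((s, A), p) \<in> r" "p = (s, B)" "(s, B) \<in> P"
      by (cases p) auto
    have "((s, A \<union> B), (s, A)) \<in> r" "((s, A \<union> B), (s, B)) \<in> r"
      using A PUn unfolding r_def by auto
    with A \<open>trans r\<close> show ?case using PUn by (metis insert_iff transD)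
  qed
  \<comment> \<open>There are only countably many stems, so grouping the conditions by their stem
    \<open>e n\<close> witnesses that \<open>r\<close> is sigma-centered.\<close>
  define e where "e = from_nat_into (Collect (finite :: 'a set \<Rightarrow> bool))"
  have e: "range e = Collect finite"
    unfolding e_def by (rule range_from_nat_into) (auto intro: countable_Collect_finite)
  have "sigma_centered r"
    unfolding sigma_centered_def Fr
  proof (intro exI[of _ "\<lambda>n. {p \<in> P. fst p = e n}"] conjI allI)
    have "fst p \<in> range e" if "p \<in> P" for p using that unfolding P_def e by auto
    then show "P = (\<Union>n. {p \<in> P. fst p = e n})" by blast
    show "centered r {p \<in> P. fst p = e n}" for n
    proof -
      have fin: "finite (e n)" using e by auto
      show ?thesis
        unfolding centered_def Fr
      proof (intro conjI allI impI)
        fix Q assume "finite Q \<and> Q \<subseteq> {p \<in> P. fst p = e n}"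
        then obtain A where "(e n, A) \<in> P" "\<forall>p\<in>Q. ((e n, A), p) \<in> r"
          using lower[of Q "e n"] fin by auto
        then show "\<exists>q\<in>P. \<forall>p\<in>Q. (q, p) \<in> r" by (rule bexI[rotated])
      qed auto
    qed
  qed
  have "Field r \<lesssim> continuum"
  proof -
    \<comment> \<open>A condition is a pair of subsets of a countable type; the tagged union codes
      it by a single set of naturals.\<close>
    define c :: "'a set \<times> 'a set \<Rightarrow> nat set"
      where "c = (\<lambda>(s, A). to_nat ` (Inl ` s \<union> Inr ` A :: ('a + 'a) set))"
    have "inj c"
    proof (rule injI)
      fix x y assume "c x = c y"
      then have "Inl ` fst x \<union> Inr ` snd x = (Inl ` fst y \<union> Inr ` snd y :: ('a + 'a) set)"
        unfolding c_def by (auto simp: inj_image_eq_iff split: prod.splits)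
      then show "x = y" by (auto intro!: prod_eqI)
    qed
    then show ?thesis unfolding lepoll_def by (auto intro: inj_on_subset)
  qed
  \<comment> \<open>\<open>D A E\<close> asks for a stem element in \<open>A\<close> beyond the
    finite set \<open>E\<close>; meeting it for every finite \<open>E\<close> makes the trace on
    \<open>A\<close> infinite. The other dense sets put each \<open>Y\<close> of \<open>\<G>\<close>
    into a promise.\<close>
  define D where "D = (\<lambda>A E. {(s, B). (s, B) \<in> P \<and> s \<inter> A - E \<noteq> {}})"
  define \<D> where "\<D> = (\<lambda>Y. {(s, B). (s, B) \<in> P \<and> Y \<subseteq> B}) ` \<G> \<union>
    (\<lambda>(A, E). D A E) ` (\<A> \<times> Collect finite)"
  have "\<D> \<prec> continuum"
    unfolding \<D>_def
    by (intro Un_lesspoll_continuum lesspoll_trans1[OF image_lepoll] assms(3)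
      Times_countable_lesspoll_continuum assms(4) countable_Collect_finite)
  moreover have "dense_in r Q" if "Q \<in> \<D>" for Q
    using that unfolding \<D>_def
  proof (elim UnE imageE)
    fix Y assume Y: "Y \<in> \<G>" and Q: "Q = {(s, B). (s, B) \<in> P \<and> Y \<subseteq> B}"
    have "\<exists>q\<in>Q. (q, (s, B)) \<in> r" if "(s, B) \<in> P" for s B
    proof
      have "(s, Y) \<in> P" using that Y unfolding P_def by (auto intro!: exI[of _ "{Y}"])
      then have "(s, B \<union> Y) \<in> P" using PUn[OF that] by blast
      then show "(s, B \<union> Y) \<in> Q" "((s, B \<union> Y), (s, B)) \<in> r"
        using that unfolding Q r_def by auto
    qed
    then show "dense_in r Q" unfolding dense_in_def Fr using Q by auto
  next
    fix z assume z: "z \<in> \<A> \<times> Collect finite" and "Q = (case z of (A, E) \<Rightarrow> D A E)"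
    then obtain A E where A: "A \<in> \<A>" "finite E" and Q: "Q = D A E" by auto
    have "\<exists>q\<in>Q. (q, (s, B)) \<in> r" if sB: "(s, B) \<in> P" for s B
    proof -
      obtain H where H: "finite s" "finite H" "H \<subseteq> \<G>" "B = \<Union>H" using sB unfolding P_def by auto
      \<comment> \<open>Positivity of \<open>A\<close> leaves a point outside the promise
        \<open>B\<close> and outside \<open>E\<close>, and adding such a point to the stem is
        permitted.\<close>
      then have "infinite (A - B)" using pos A by auto
      then have "infinite (A - B - E)" using A by auto
      then obtain t where t: "t \<in> A - B - E" by (metis ex_in_conv finite.emptyI)
      have "(insert t s, B) \<in> P" using H unfolding P_def by auto
      then have "(insert t s, B) \<in> Q" "((insert t s, B), (s, B)) \<in> r"
        using t sB unfolding Q D_def r_def by auto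
      then show ?thesis by blast
    qed
    then show "dense_in r Q" unfolding dense_in_def Fr by (auto simp: Q D_def)
  qed
  ultimately obtain G where G: "filter_in r G" "\<And>Q. Q \<in> \<D> \<Longrightarrow> G \<inter> Q \<noteq> {}"
    using MA_sigma_centered_filter[OF MA po ne \<open>sigma_centered r\<close> \<open>Field r \<lesssim> continuum\<close>] by metis
  define X where "X = \<Union>(fst ` G)"
  show ?thesis
  proof (rule that[of X])
    fix Y assume Y: "Y \<in> \<G>"
    then have "{(s, B). (s, B) \<in> P \<and> Y \<subseteq> B} \<in> \<D>" unfolding \<D>_def by blast
    then obtain s B where sB: "(s, B) \<in> G" "(s, B) \<in> P" "Y \<subseteq> B" using G(2) by blast
    \<comment> \<open>Once a condition of \<open>G\<close> with stem \<open>s\<close> promises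
      \<open>Y\<close>, its common extension with any other condition of \<open>G\<close> shows that
      no point of \<open>Y\<close> outside \<open>s\<close> is ever added.\<close>
    have "X \<inter> Y \<subseteq> s"
    proof
      fix x assume x: "x \<in> X \<inter> Y"
      then obtain t C where tC: "(t, C) \<in> G" "x \<in> t" unfolding X_def by auto
      then obtain u where "u \<in> G" "(u, (s, B)) \<in> r" "(u, (t, C)) \<in> r"
        using G(1) sB(1) unfolding filter_in_def by blast
      then show "x \<in> s" using x tC sB(3) unfolding r_def by blast
    qed
    moreover have "finite s" using sB unfolding P_def by auto
    ultimately show "finite (X \<inter> Y)" by (rule finite_subset)
  next
    fix A assume A: "A \<in> \<A>"
    show "infinite (X \<inter> A)"
    proof
      assume fin: "finite (X \<inter> A)"
      \<comment> \<open>A finite trace \<open>X \<inter> A\<close> can itself serve as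
        \<open>E\<close>; a condition meeting this dense set has a stem exceeding it.\<close>
      have "D A (X \<inter> A) \<in> \<D>" unfolding \<D>_def using A fin by blast
      then obtain s B where "(s, B) \<in> G" "s \<inter> A - X \<inter> A \<noteq> {}" using G(2) unfolding D_def by blast
      then show False unfolding X_def by force
    qed
  qed
qed

text \<open>The last property treats countably many sets at once because the possible values of a Cohen
  name form a countable family; one set at a time would require that the continuum has
  uncountable cofinality.\<close>

theorem MA_ad_family_exists:
  assumes MA: "continuum \<lesssim> (UNIV :: 'u set)" "MA_sigma_centered TYPE('u)"
    and inf: "infinite (UNIV :: 'a :: countable set)"
  obtains F :: "'a :: countable set set" where "ad_family F" "\<Union>F = UNIV" "F \<approx> continuum"
    "\<And>A :: nat \<Rightarrow> 'a :: countable set. \<exists>S. S \<prec> continuum \<and> (\<forall>X\<in>F - S. \<forall>n.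
      infinite (X \<inter> A n) \<or> (\<exists>H. finite H \<and> H \<subseteq> F \<and> finite (A n - \<Union>H)))"
proof -
  \<comment> \<open>A bijection with the pairs of naturals splits the type into infinitely many
    infinite pieces \<open>P n\<close>. As members of \<open>F\<close> they provide the covering,
    and since there are infinitely many, no finite part of the family exhausts the type.\<close>
  define g where "g = to_nat_on (UNIV :: 'a set)"
  have g: "bij g" unfolding g_def using to_nat_on_infinite[OF _ inf] by simp
  define P where "P n = {a. fst (prod_decode (g a)) = n}" for n
  have inf_P: "infinite (P n)" for n
  proof -
    have "inj (\<lambda>m. inv g (prod_encode (n, m)))"
      using g by (auto simp: inj_on_def bij_def dest!: inv_into_injective)
    then have "infinite (range (\<lambda>m. inv g (prod_encode (n, m))))"
      using finite_imageD by blast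
    moreover have "range (\<lambda>m. inv g (prod_encode (n, m))) \<subseteq> P n"
      using g by (auto simp: P_def bij_def surj_f_inv_f)
    ultimately show ?thesis using finite_subset by blast
  qed
  have disj_P: "P m \<inter> P n = {}" if "m \<noteq> n" for m n using that unfolding P_def by auto
  then have inj_P: "inj P" using inf_P by (metis Int_absorb finite.emptyI injI)
  \<comment> \<open>The recursion runs along a well-order of the sets of naturals of least possible
    type, so that every initial segment \<open>below x\<close> is smaller than the
    continuum.\<close>
  define R where "R = card_of (UNIV :: nat set set) - Id"
  have wo: "Well_order (card_of (UNIV :: nat set set))" by (rule card_of_Well_order)
  then have "wf R" unfolding R_def well_order_on_def by blast
  have total: "x = y \<or> (x, y) \<in> R \<or> (y, x) \<in> R" for x y
    using wo unfolding R_def well_order_on_def linear_order_on_def total_on_def by (simp add: Field_card_of) blast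
  define below where "below x = {y. (y, x) \<in> R}" for x
  have small: "below x \<prec> continuum" for x
  proof -
    have "below x = underS (card_of UNIV) x" unfolding below_def R_def underS_def by auto
    then show ?thesis
      unfolding lesspoll_iff_card_of using card_of_underS[OF card_of_Card_order, of x UNIV] by (simp add: Field_card_of)
  qed
  \<comment> \<open>The stage \<open>x\<close> is read as a code of a sequence of sets; by
    \<open>dec_surj\<close> every sequence is listed at some stage.\<close>
  define dec :: "nat set \<Rightarrow> nat \<Rightarrow> 'a set" where "dec x n = {a. prod_encode (n, to_nat a) \<in> x}" for x n
  have dec_surj: "\<exists>x. dec x = A" for A
    by (intro exI[of _ "{prod_encode (n, to_nat a) | n a. a \<in> A n}"]) (auto simp: dec_def fun_eq_iff)
  \<comment> \<open>\<open>\<G> f x\<close> is the family before stage \<open>x\<close>, and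
    \<open>pos f x A\<close> says that \<open>A\<close> lies outside the ideal generated by it and
    the finite sets. \<open>Q\<close> makes the new member almost disjoint from the old ones while
    meeting infinitely every positive set listed up to stage \<open>x\<close>.\<close>
  define \<G> where "\<G> f x = range P \<union> f ` below x" for f x
  define pos where "pos f x A \<longleftrightarrow> (\<forall>H. finite H \<and> H \<subseteq> \<G> f x \<longrightarrow> infinite (A - \<Union>H))" for f x A
  define Q where "Q f x X \<longleftrightarrow> (\<forall>Y\<in>\<G> f x. finite (X \<inter> Y)) \<and>
    (\<forall>y\<in>insert x (below x). \<forall>n. pos f x (dec y n) \<longrightarrow> infinite (X \<inter> dec y n)) \<and>
    infinite X" for f x X
  have "\<exists>f. \<forall>x. Q f x (f x)"
  proof (rule dependent_wf_choice[OF \<open>wf R\<close>])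
    \<comment> \<open>The requirement at \<open>x\<close> depends on \<open>f\<close> only through
      its earlier values, as well-founded choice demands.\<close>
    fix f h :: "nat set \<Rightarrow> 'a set" and x X assume "\<And>z. (z, x) \<in> R \<Longrightarrow> f z = h z"
    then have "\<G> f x = \<G> h x" unfolding \<G>_def below_def by auto
    then show "Q f x X = Q h x X" unfolding Q_def pos_def by simp
  next
    fix x f assume IH: "\<And>y. (y, x) \<in> R \<Longrightarrow> Q f y (f y)"
    \<comment> \<open>Some piece \<open>P n\<close> outside \<open>H\<close> is almost disjoint from
      every member of \<open>H\<close>, so \<open>H\<close> cannot almost cover even this
      piece.\<close>
    have pos_UNIV: "pos f x UNIV"
      unfolding pos_def
    proof (intro allI impI)
      fix H assume H: "finite H \<and> H \<subseteq> \<G> f x"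
      have "infinite (range P)" using inj_P finite_imageD by blast
      then obtain n where n: "P n \<notin> H" using H by (meson finite_subset image_subsetI)
      have "finite (P n \<inter> Y)" if YH: "Y \<in> H" for Y
      proof (cases "Y \<in> range P")
        case True
        then obtain m where "Y = P m" by auto
        with YH n have "P n \<inter> Y = {}" using disj_P by metis
        then show ?thesis by simp
      next
        case False
        then obtain y where "(y, x) \<in> R" "Y = f y" using YH H unfolding \<G>_def below_def by auto
        with IH show ?thesis unfolding Q_def \<G>_def by (auto simp: Int_commute)
      qed
      then have "finite (\<Union>Y\<in>H. P n \<inter> Y)" using H by blast
      then have "finite (P n \<inter> \<Union>H)" by (rule finite_subset[rotated]) blast
      then have "infinite (P n - \<Union>H)" using inf_P by (metis Un_Diff_Int finite_Un)
      then show "infinite (UNIV - \<Union>H)" by (rule contrapos_nn) (auto elim: finite_subset[rotated])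
    qed
    \<comment> \<open>Adding the whole type to the sets that must be met is what makes the new
      member infinite.\<close>
    define \<A> where "\<A> = insert UNIV {A \<in> (\<lambda>(y, n). dec y n) ` (insert x (below x) \<times> UNIV). pos f x A}"
    have "\<G> f x \<prec> continuum"
      unfolding \<G>_def
      by (intro Un_lesspoll_continuum lesspoll_trans1[OF image_lepoll] small
        countable_lesspoll_continuum) auto
    moreover have "\<A> \<prec> continuum"
    proof -
      have "insert x (below x) \<prec> continuum"
        using Un_lesspoll_continuum[OF countable_lesspoll_continuum[of "{x}"] small[of x]] by simp
      then have "insert x (below x) \<times> (UNIV :: nat set) \<prec> continuum"
        by (rule Times_countable_lesspoll_continuum) simp
      then have "(\<lambda>(y, n). dec y n) ` (insert x (below x) \<times> UNIV) \<prec> continuum"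
        by (rule lesspoll_trans1[OF image_lepoll])
      then have "{UNIV} \<union> (\<lambda>(y, n). dec y n) ` (insert x (below x) \<times> UNIV) \<prec> continuum"
        by (rule Un_lesspoll_continuum[OF countable_lesspoll_continuum, rotated]) simp
      moreover have "\<A> \<subseteq> {UNIV} \<union> (\<lambda>(y, n). dec y n) ` (insert x (below x) \<times> UNIV)"
        unfolding \<A>_def by blast
      ultimately show ?thesis by (rule lesspoll_trans1[OF subset_imp_lepoll, rotated])
    qed
    moreover have "infinite (A - \<Union>H)" if "A \<in> \<A>" "H \<subseteq> \<G> f x" "finite H" for A H
    proof -
      have "pos f x A" using that(1) pos_UNIV unfolding \<A>_def by auto
      with that show ?thesis unfolding pos_def by blast
    qed
    ultimately obtain X where X: "\<And>Y. Y \<in> \<G> f x \<Longrightarrow> finite (X \<inter> Y)"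
        "\<And>A. A \<in> \<A> \<Longrightarrow> infinite (X \<inter> A)"
      using MA_almost_disjoint_meeting[OF MA, of "\<G> f x" \<A>] by metis
    have "Q f x X"
      unfolding Q_def
    proof (intro conjI ballI allI impI)
      show "finite (X \<inter> Y)" if "Y \<in> \<G> f x" for Y using X(1) that .
      show "infinite (X \<inter> dec y n)" if "y \<in> insert x (below x)" "pos f x (dec y n)" for y n
        using that by (intro X(2)) (auto simp: \<A>_def)
      show "infinite X" using X(2)[of UNIV] unfolding \<A>_def by simp
    qed
    then show "\<exists>X. Q f x X" ..
  qed
  then obtain f where f: "\<And>x. Q f x (f x)" by blast
  have inf_f: "infinite (f x)" for x using f unfolding Q_def by blast
  have f_P: "finite (f x \<inter> P n)" for x n using f[of x] unfolding Q_def \<G>_def by auto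
  have f_lt: "finite (f x \<inter> f y)" if "(y, x) \<in> R" for x y
    using f[of x] that unfolding Q_def \<G>_def below_def by auto
  have f_f: "finite (f x \<inter> f y)" if "x \<noteq> y" for x y
    using total[of x y] f_lt[of x y] f_lt[of y x] that by (auto simp: Int_commute)
  define F where "F = range P \<union> range f"
  have "ad_family F"
    unfolding ad_family_def
  proof (intro conjI ballI impI)
    show "infinite X" if "X \<in> F" for X using that inf_P inf_f unfolding F_def by auto
    fix X Y assume "X \<in> F" "Y \<in> F" "X \<noteq> Y"
    then show "finite (X \<inter> Y)"
      unfolding F_def
    proof (elim UnE imageE)
      show ?thesis if "X = P m" "Y = P n" for m n
        using that \<open>X \<noteq> Y\<close> disj_P[of m n] by fastforce
      show ?thesis if "X = P n" "Y = f x" for n x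
        using that f_P[of x n] by (simp add: Int_commute)
      show ?thesis if "X = f x" "Y = P n" for n x
        using that f_P[of x n] by simp
      show ?thesis if "X = f x" "Y = f y" for x y
        using that \<open>X \<noteq> Y\<close> f_f[of x y] by fastforce
    qed
  qed
  moreover have "\<Union>F = UNIV" unfolding F_def P_def by auto
  moreover have "F \<approx> continuum"
  proof (rule lepoll_antisym)
    have "inj (image to_nat :: 'a set \<Rightarrow> nat set)" by (simp add: inj_image_eq_iff inj_def)
    then show "F \<lesssim> continuum" unfolding lepoll_def by (meson inj_on_subset subset_UNIV)
    \<comment> \<open>A value shared by two stages would be almost disjoint from itself, hence
      finite.\<close>
    have "inj f" using f_f inf_f by (metis Int_absorb injI)
    then show "continuum \<lesssim> F" unfolding lepoll_def F_def by blast
  qed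
  moreover have "\<exists>S. S \<prec> continuum \<and> (\<forall>X\<in>F - S. \<forall>n.
      infinite (X \<inter> A n) \<or> (\<exists>H. finite H \<and> H \<subseteq> F \<and> finite (A n - \<Union>H)))" for A :: "nat \<Rightarrow> 'a set"
  proof -
    \<comment> \<open>The exceptional members are the pieces and those added before the stage
      \<open>y\<close> that lists \<open>A\<close>. From stage \<open>y\<close> on, a new member
      \<open>f x\<close> has to meet every \<open>A n\<close> that is still positive; an
      \<open>A n\<close> that is not positive is almost covered by finitely many members of
      \<open>F\<close>.\<close>
    obtain y where y: "dec y = A" using dec_surj by blast
    have "\<G> f y \<prec> continuum"
      unfolding \<G>_def
      by (intro Un_lesspoll_continuum lesspoll_trans1[OF image_lepoll] small
        countable_lesspoll_continuum) auto
    moreover have "infinite (X \<inter> A n) \<or> (\<exists>H. finite H \<and> H \<subseteq> F \<and> finite (A n - \<Union>H))"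
      if X: "X \<in> F - \<G> f y" for X n
    proof -
      obtain x where x: "X = f x" "x \<notin> below y" using X unfolding F_def \<G>_def by auto
      then have "y \<in> insert x (below x)" using total[of x y] unfolding below_def by auto
      with f[of x] have "pos f x (A n) \<longrightarrow> infinite (X \<inter> A n)"
        unfolding Q_def x(1) y[symmetric] by blast
      moreover have "\<G> f x \<subseteq> F" unfolding \<G>_def F_def by auto
      ultimately show ?thesis unfolding pos_def by (meson subset_trans)
    qed
    ultimately show ?thesis by blast
  qed
  ultimately show ?thesis by (rule that)
qed

section \<open>Forcing over a preorder\<close>

text \<open>Up to finitely many points, \<open>A\<close> is the union of its traces on the finitely
  many members of \<open>H\<close>. This serves to drop from a cover the sets that meet
  \<open>A\<close> finitely.\<close>

lemma finite_if_finite_Int_cover: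
  assumes "finite H" "finite (A - \<Union>H)" "\<And>Z. Z \<in> H \<Longrightarrow> finite (A \<inter> Z)"
  shows "finite A"
proof (rule finite_subset)
  show "A \<subseteq> (A - \<Union>H) \<union> \<Union>((\<inter>) A ` H)" by blast
  show "finite ((A - \<Union>H) \<union> \<Union>((\<inter>) A ` H))" using assms by blast
qed

lemma ad_familyD:
  assumes "ad_family F" "X \<in> F"
  shows "infinite X" and "Y \<in> F \<Longrightarrow> X \<noteq> Y \<Longrightarrow> finite (X \<inter> Y)"
  using assms unfolding ad_family_def by blast+

locale forcing_preorder = forcing r for r :: "'c rel" +
  assumes le_refl: "p \<in> Field r \<Longrightarrow> (p, p) \<in> r"
    and le_trans: "(p, q) \<in> r \<Longrightarrow> (q, s) \<in> r \<Longrightarrow> (p, s) \<in> r"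
begin

text \<open>Regular open sets of conditions; on these the connectives defined by double negation, such as
  \<open>f_imp\<close>, satisfy the familiar clauses of the forcing relation.\<close>

definition regular :: "'c set \<Rightarrow> bool"
  where "regular \<phi> \<longleftrightarrow> \<phi> \<subseteq> Field r \<and> (\<forall>p\<in>\<phi>. \<forall>q. (q, p) \<in> r \<longrightarrow> q \<in> \<phi>) \<and>
    (\<forall>p\<in>Field r. (\<forall>q. (q, p) \<in> r \<longrightarrow> (\<exists>s. (s, q) \<in> r \<and> s \<in> \<phi>)) \<longrightarrow> p \<in> \<phi>)"

lemma regularD_Field: "regular \<phi> \<Longrightarrow> p \<in> \<phi> \<Longrightarrow> p \<in> Field r"
  unfolding regular_def by blast

lemma regularD_mono: "regular \<phi> \<Longrightarrow> p \<in> \<phi> \<Longrightarrow> (q, p) \<in> r \<Longrightarrow> q \<in> \<phi>"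
  unfolding regular_def by blast

lemma regularD_dense:
  "regular \<phi> \<Longrightarrow> p \<in> Field r \<Longrightarrow> (\<And>q. (q, p) \<in> r \<Longrightarrow> \<exists>s. (s, q) \<in> r \<and> s \<in> \<phi>) \<Longrightarrow> p \<in> \<phi>"
  unfolding regular_def by blast

section \<open>Forcing clauses and regularity of the connectives\<close>

lemma forces_not: "p \<in> (\<^bold>\<not> \<phi>) \<longleftrightarrow> p \<in> Field r \<and> (\<forall>q. (q, p) \<in> r \<longrightarrow> q \<notin> \<phi>)"
  unfolding f_not_def by blast

lemma forces_and: "p \<in> (\<phi> \<^bold>\<and> \<psi>) \<longleftrightarrow> p \<in> \<phi> \<and> p \<in> \<psi>"
  unfolding f_and_def by blast

lemma forces_all: "p \<in> (\<^bold>\<forall>x. \<phi> x) \<longleftrightarrow> p \<in> Field r \<and> (\<forall>x. p \<in> \<phi> x)"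
  unfolding f_all_def by blast

lemma forces_or:
  "p \<in> (\<phi> \<^bold>\<or> \<psi>) \<longleftrightarrow> p \<in> Field r \<and> (\<forall>q. (q, p) \<in> r \<longrightarrow> (\<exists>s. (s, q) \<in> r \<and> (s \<in> \<phi> \<or> s \<in> \<psi>)))"
  unfolding f_or_def f_and_def f_not_def by (auto intro: FieldI1)

lemma forces_ex:
  "p \<in> (\<^bold>\<exists>x. \<phi> x) \<longleftrightarrow> p \<in> Field r \<and> (\<forall>q. (q, p) \<in> r \<longrightarrow> (\<exists>s x. (s, q) \<in> r \<and> s \<in> \<phi> x))"
  unfolding f_ex_def f_all_def f_not_def
  by (intro iffI conjI allI impI; simp) (meson FieldI1)+

text \<open>If \<open>q\<close> below \<open>p\<close> is in \<open>\<phi>\<close>, no extension of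
  \<open>q\<close> can force the negation of \<open>\<psi>\<close>, so \<open>\<psi>\<close> is
  dense below \<open>q\<close>; regularity then gives \<open>q \<in> \<psi>\<close>.\<close>

lemma forces_imp:
  assumes "regular \<phi>" "regular \<psi>"
  shows "p \<in> (\<phi> \<^bold>\<longrightarrow> \<psi>) \<longleftrightarrow> p \<in> Field r \<and> (\<forall>q. (q, p) \<in> r \<longrightarrow> q \<in> \<phi> \<longrightarrow> q \<in> \<psi>)"
proof -
  have "q \<in> \<psi>" if p: "p \<in> (\<phi> \<^bold>\<longrightarrow> \<psi>)" and q: "(q, p) \<in> r" "q \<in> \<phi>" for q
  proof (rule regularD_dense[OF assms(2)])
    show "q \<in> Field r" using q(1) by (rule FieldI1)
    fix s assume s: "(s, q) \<in> r"
    then have "s \<in> \<phi>" "(s, p) \<in> r" using q regularD_mono[OF assms(1)] le_trans by blast+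
    moreover from this have "s \<notin> (\<phi> \<^bold>\<and> \<^bold>\<not> \<psi>)" using p unfolding f_imp_def forces_not by blast
    ultimately have "s \<notin> (\<^bold>\<not> \<psi>)" unfolding f_and_def by blast
    then show "\<exists>t. (t, s) \<in> r \<and> t \<in> \<psi>" using FieldI1[OF s] unfolding forces_not by blast
  qed
  moreover have "q \<notin> (\<phi> \<^bold>\<and> \<^bold>\<not> \<psi>)" if "(q, p) \<in> r" "q \<in> \<phi> \<longrightarrow> q \<in> \<psi>" for q
    using that le_refl[of q] unfolding forces_and forces_not by blast
  ultimately show ?thesis unfolding f_imp_def forces_not by blast
qed

lemma forces_iff:
  assumes "regular \<phi>" "regular \<psi>"
  shows "p \<in> (\<phi> \<^bold>\<longleftrightarrow> \<psi>) \<longleftrightarrow> p \<in> Field r \<and> (\<forall>q. (q, p) \<in> r \<longrightarrow> (q \<in> \<phi> \<longleftrightarrow> q \<in> \<psi>))"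
  unfolding f_iff_def forces_and using assms by (auto simp: forces_imp)

lemma regular_not [simp]: "regular \<phi> \<Longrightarrow> regular (\<^bold>\<not> \<phi>)"
  unfolding regular_def[of "\<^bold>\<not> \<phi>"] forces_not
proof (intro conjI ballI allI impI)
  assume reg: "regular \<phi>"
  show "(\<^bold>\<not> \<phi>) \<subseteq> Field r" unfolding f_not_def by blast
  show "q \<in> Field r" if "(q, p) \<in> r" for p q using that by (rule FieldI1)
  show "s \<notin> \<phi>" if "p \<in> (\<^bold>\<not> \<phi>)" "(q, p) \<in> r" "(s, q) \<in> r" for p q s
    using that le_trans unfolding forces_not by blast
  show "q \<notin> \<phi>" if dense: "\<forall>q. (q, p) \<in> r \<longrightarrow> (\<exists>s. (s, q) \<in> r \<and> s \<in> Field r \<and> (\<forall>q. (q, s) \<in> r \<longrightarrow> q \<notin> \<phi>))"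
    and q: "(q, p) \<in> r" for p q
  proof
    assume "q \<in> \<phi>"
    from dense q obtain s where "(s, q) \<in> r" "s \<in> Field r" "\<forall>q. (q, s) \<in> r \<longrightarrow> q \<notin> \<phi>" by blast
    with \<open>q \<in> \<phi>\<close> regularD_mono[OF reg] le_refl show False by blast
  qed
qed

lemma regular_and [simp]: "regular \<phi> \<Longrightarrow> regular \<psi> \<Longrightarrow> regular (\<phi> \<^bold>\<and> \<psi>)"
  unfolding regular_def[of "\<phi> \<^bold>\<and> \<psi>"] forces_and
proof (intro conjI ballI allI impI)
  assume reg: "regular \<phi>" "regular \<psi>"
  show "(\<phi> \<^bold>\<and> \<psi>) \<subseteq> Field r" using regularD_Field[OF reg(1)] unfolding f_and_def by blast
  show "q \<in> \<phi>" "q \<in> \<psi>" if "p \<in> (\<phi> \<^bold>\<and> \<psi>)" "(q, p) \<in> r" for p q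
    using that reg[THEN regularD_mono] unfolding forces_and by blast+
  show "p \<in> \<phi>" "p \<in> \<psi>"
    if "p \<in> Field r" "\<forall>q. (q, p) \<in> r \<longrightarrow> (\<exists>s. (s, q) \<in> r \<and> s \<in> \<phi> \<and> s \<in> \<psi>)" for p
  proof -
    show "p \<in> \<phi>" using that by (intro regularD_dense[OF reg(1)]) blast+
    show "p \<in> \<psi>" using that by (intro regularD_dense[OF reg(2)]) blast+
  qed
qed

lemma regular_all [simp]: "(\<And>x. regular (\<phi> x)) \<Longrightarrow> regular (\<^bold>\<forall>x. \<phi> x)"
  unfolding regular_def[of "\<^bold>\<forall>x. \<phi> x"] forces_all
proof (intro conjI ballI allI impI)
  assume reg: "\<And>x. regular (\<phi> x)"
  show "(\<^bold>\<forall>x. \<phi> x) \<subseteq> Field r" unfolding f_all_def by blast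
  show "q \<in> Field r" if "(q, p) \<in> r" for p q using that by (rule FieldI1)
  show "q \<in> \<phi> x" if "p \<in> (\<^bold>\<forall>x. \<phi> x)" "(q, p) \<in> r" for p q x
    using that regularD_mono[OF reg] unfolding forces_all by blast
  show "p \<in> \<phi> x" if "p \<in> Field r" "\<forall>q. (q, p) \<in> r \<longrightarrow> (\<exists>s. (s, q) \<in> r \<and> s \<in> Field r \<and> (\<forall>x. s \<in> \<phi> x))" for p x
    using that by (intro regularD_dense[OF reg]) blast+
qed

lemma regular_or [simp]: "regular \<phi> \<Longrightarrow> regular \<psi> \<Longrightarrow> regular (\<phi> \<^bold>\<or> \<psi>)"
  unfolding f_or_def by simp

lemma regular_imp [simp]: "regular \<phi> \<Longrightarrow> regular \<psi> \<Longrightarrow> regular (\<phi> \<^bold>\<longrightarrow> \<psi>)"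
  unfolding f_imp_def by simp

lemma regular_iff [simp]: "regular \<phi> \<Longrightarrow> regular \<psi> \<Longrightarrow> regular (\<phi> \<^bold>\<longleftrightarrow> \<psi>)"
  unfolding f_iff_def by simp

lemma regular_ex [simp]: "(\<And>x. regular (\<phi> x)) \<Longrightarrow> regular (\<^bold>\<exists>x. \<phi> x)"
  unfolding f_ex_def by simp

lemma regular_id [simp]: "regular (a \<^bold>= b)"
  unfolding regular_def f_id_def using le_refl by (blast intro: FieldI1)

text \<open>Density below densely many conditions is density again, so repeating the demand adds no
  new conditions. The clauses of \<open>f_mem\<close> and \<open>f_fam_mem\<close> have this
  shape.\<close>

lemma regular_densely:
  assumes "\<And>p q. p \<in> W \<Longrightarrow> (q, p) \<in> r \<Longrightarrow> q \<in> W" "W \<subseteq> Field r"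
  shows "regular {p \<in> Field r. \<forall>q. (q, p) \<in> r \<longrightarrow> (\<exists>s. (s, q) \<in> r \<and> s \<in> W)}"
  unfolding regular_def
proof (intro conjI ballI allI impI, goal_cases)
  case (2 p q)
  then show ?case using le_trans by (blast intro: FieldI1)
next
  case (3 p)
  have "\<exists>s. (s, q) \<in> r \<and> s \<in> W" if q: "(q, p) \<in> r" for q
  proof -
    obtain s where s: "(s, q) \<in> r" "s \<in> Field r" "\<forall>q. (q, s) \<in> r \<longrightarrow> (\<exists>s. (s, q) \<in> r \<and> s \<in> W)"
      using 3(2) q by blast
    then obtain t where "(t, s) \<in> r" "t \<in> W" using le_refl by blast
    with s(1) show ?thesis using le_trans by blast
  qed
  with 3(1) show ?case by blast
qed blast

lemma regular_mem [simp]: "regular (a \<^bold>\<in> X)"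
proof -
  have "(a \<^bold>\<in> X) = {p \<in> Field r. \<forall>q. (q, p) \<in> r \<longrightarrow>
      (\<exists>s. (s, q) \<in> r \<and> s \<in> {s. \<exists>u. (a, u) \<in> X \<and> (s, u) \<in> r})}"
    unfolding f_mem_def by blast
  also have "regular \<dots>"
    by (rule regular_densely) (blast intro: FieldI1 le_trans)+
  finally show ?thesis .
qed

lemma regular_subset [simp]: "regular (X \<^bold>\<subseteq> Y)"
  unfolding f_subset_def by simp

lemma regular_eq [simp]: "regular (X \<^bold>\<equiv> Y)"
  unfolding f_eq_def by simp

lemma regular_eqpoll [simp]: "regular (X \<^bold>\<approx> Y)"
  unfolding f_eqpoll_def by simp

lemma regular_finite [simp]: "regular (f_finite X)"
  unfolding f_finite_def by simp

lemma fam_mem_densely: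
  "(Y \<^bold>\<in>\<^bold>\<in> \<G>) = {p \<in> Field r. \<forall>q. (q, p) \<in> r \<longrightarrow>
      (\<exists>s. (s, q) \<in> r \<and> s \<in> {s. \<exists>Z u. (Z, u) \<in> \<G> \<and> (s, u) \<in> r \<and> s \<in> (Y \<^bold>\<equiv> Z)})}"
  unfolding f_fam_mem_def by blast

lemma regular_fam_mem [simp]: "regular (Y \<^bold>\<in>\<^bold>\<in> \<G>)"
  unfolding fam_mem_densely
proof (rule regular_densely)
  show "q \<in> {s. \<exists>Z u. (Z, u) \<in> \<G> \<and> (s, u) \<in> r \<and> s \<in> (Y \<^bold>\<equiv> Z)}"
    if "p \<in> {s. \<exists>Z u. (Z, u) \<in> \<G> \<and> (s, u) \<in> r \<and> s \<in> (Y \<^bold>\<equiv> Z)}" "(q, p) \<in> r" for p q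
    using that regularD_mono[OF regular_eq] le_trans by blast
qed (blast intro: FieldI1)

lemma regular_in_perp [simp]: "regular (f_in_perp Y \<B>)"
  unfolding f_in_perp_def by simp

lemma regular_in_ideal [simp]: "regular (f_in_ideal Y \<G>)"
  unfolding f_in_ideal_def by simp

lemma regular_almost_decides [simp]: "regular (f_almost_decides \<B> F)"
  unfolding f_almost_decides_def by simp

lemma regular_ad_family [simp]: "regular (f_ad_family \<G>)"
  unfolding f_ad_family_def by simp

section \<open>Membership in canonical names and check names\<close>

lemma forces_Collect:
  assumes "regular (\<phi> a)"
  shows "(a \<^bold>\<in> f_Collect \<phi>) = \<phi> a"
proof -
  \<comment> \<open>Membership in the canonical name only says that \<open>\<phi> a\<close> is dense
    below \<open>p\<close>; regularity removes the density.\<close>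
  have "p \<in> \<phi> a" if "p \<in> (a \<^bold>\<in> f_Collect \<phi>)" for p
  proof (rule regularD_dense[OF assms])
    show "p \<in> Field r" using that unfolding f_mem_def by blast
    show "\<exists>s. (s, q) \<in> r \<and> s \<in> \<phi> a" if "(q, p) \<in> r" for q
      using that \<open>p \<in> (a \<^bold>\<in> f_Collect \<phi>)\<close> regularD_mono[OF assms]
      unfolding f_mem_def f_Collect_def by blast
  qed
  moreover have "p \<in> (a \<^bold>\<in> f_Collect \<phi>)" if "p \<in> \<phi> a" for p
    using that regularD_mono[OF assms] regularD_Field[OF assms] le_refl
    unfolding f_mem_def f_Collect_def by blast
  ultimately show ?thesis by blast
qed

text \<open>Each \<open>a \<in> A\<close> is paired in \<open>check A\<close> with every condition,
  so every \<open>q\<close> can be its own witness.\<close>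

lemma forces_mem_check: "p \<in> (a \<^bold>\<in> check A) \<longleftrightarrow> p \<in> Field r \<and> a \<in> A"
proof -
  have "(\<exists>s u. (s, q) \<in> r \<and> (a, u) \<in> A \<times> Field r \<and> (s, u) \<in> r) \<longleftrightarrow> a \<in> A" if "(q, p) \<in> r" for q
    using le_refl[OF FieldI1[OF that]] FieldI1[OF that] by blast
  then show ?thesis unfolding f_mem_def check_def using le_refl by blast
qed

lemma forces_mem_inter: "p \<in> (a \<^bold>\<in> X \<^bold>\<inter> Y) \<longleftrightarrow> p \<in> (a \<^bold>\<in> X) \<and> p \<in> (a \<^bold>\<in> Y)"
  unfolding f_inter_def by (simp add: forces_Collect forces_and)

lemma forces_mem_diff: "p \<in> (a \<^bold>\<in> X \<^bold>- Y) \<longleftrightarrow> p \<in> (a \<^bold>\<in> X) \<and> p \<in> (\<^bold>\<not> a \<^bold>\<in> Y)"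
  unfolding f_diff_def by (simp add: forces_Collect forces_and)

lemma forces_subset:
  "p \<in> (X \<^bold>\<subseteq> Y) \<longleftrightarrow> p \<in> Field r \<and> (\<forall>q a. (q, p) \<in> r \<longrightarrow> q \<in> (a \<^bold>\<in> X) \<longrightarrow> q \<in> (a \<^bold>\<in> Y))"
  unfolding f_subset_def forces_all by (auto simp: forces_imp)

lemma forces_check_fam:
  "p \<in> (Y \<^bold>\<in>\<^bold>\<in> check_fam F) \<longleftrightarrow>
    p \<in> Field r \<and> (\<forall>q. (q, p) \<in> r \<longrightarrow> (\<exists>s. (s, q) \<in> r \<and> (\<exists>Z\<in>F. s \<in> (Y \<^bold>\<equiv> check Z))))"
proof -
  have "(\<exists>Z u. (Z, u) \<in> check_fam F \<and> (s, u) \<in> r \<and> s \<in> (Y \<^bold>\<equiv> Z)) \<longleftrightarrow>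
      (\<exists>Z\<in>F. s \<in> (Y \<^bold>\<equiv> check Z))" if "(s, q) \<in> r" for s q
    using le_refl[OF FieldI1[OF that]] FieldI1[OF that]
    unfolding check_fam_def check_def[of "check ` F"] by blast
  then show ?thesis unfolding f_fam_mem_def by blast
qed

text \<open>This expresses that \<open>s\<close> forces \<open>R\<close> to be a bijection from
  \<open>X\<close> onto \<open>Y\<close>, with the connectives unfolded. The two existence clauses
  become density below \<open>s\<close>.\<close>

definition bij_name :: "'c \<Rightarrow> ('a \<times> 'b, 'c) name \<Rightarrow> ('a, 'c) name \<Rightarrow> ('b, 'c) name \<Rightarrow> bool"
  where "bij_name s R X Y \<longleftrightarrow> s \<in> Field r \<and>
    (\<forall>t x y. (t, s) \<in> r \<longrightarrow> t \<in> ((x, y) \<^bold>\<in> R) \<longrightarrow> t \<in> (x \<^bold>\<in> X) \<and> t \<in> (y \<^bold>\<in> Y)) \<and>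
    (\<forall>t x. (t, s) \<in> r \<longrightarrow> t \<in> (x \<^bold>\<in> X) \<longrightarrow> (\<exists>u y. (u, t) \<in> r \<and> u \<in> ((x, y) \<^bold>\<in> R))) \<and>
    (\<forall>t y. (t, s) \<in> r \<longrightarrow> t \<in> (y \<^bold>\<in> Y) \<longrightarrow> (\<exists>u x. (u, t) \<in> r \<and> u \<in> ((x, y) \<^bold>\<in> R))) \<and>
    (\<forall>t x y y'. (t, s) \<in> r \<longrightarrow> t \<in> ((x, y) \<^bold>\<in> R) \<longrightarrow> t \<in> ((x, y') \<^bold>\<in> R) \<longrightarrow> y = y') \<and>
    (\<forall>t x x' y. (t, s) \<in> r \<longrightarrow> t \<in> ((x, y) \<^bold>\<in> R) \<longrightarrow> t \<in> ((x', y) \<^bold>\<in> R) \<longrightarrow> x = x')"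

lemma bij_nameD:
  assumes "bij_name s R X Y" "(t, s) \<in> r"
  shows "t \<in> ((x, y) \<^bold>\<in> R) \<Longrightarrow> t \<in> (x \<^bold>\<in> X)"
    and "t \<in> ((x, y) \<^bold>\<in> R) \<Longrightarrow> t \<in> (y \<^bold>\<in> Y)"
    and "t \<in> (x \<^bold>\<in> X) \<Longrightarrow> \<exists>u y. (u, t) \<in> r \<and> u \<in> ((x, y) \<^bold>\<in> R)"
    and "t \<in> (y \<^bold>\<in> Y) \<Longrightarrow> \<exists>u x. (u, t) \<in> r \<and> u \<in> ((x, y) \<^bold>\<in> R)"
    and "t \<in> ((x, y) \<^bold>\<in> R) \<Longrightarrow> t \<in> ((x, y') \<^bold>\<in> R) \<Longrightarrow> y = y'"
    and "t \<in> ((x, y) \<^bold>\<in> R) \<Longrightarrow> t \<in> ((x', y) \<^bold>\<in> R) \<Longrightarrow> x = x'"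
proof -
  note D = assms(1)[unfolded bij_name_def, THEN conjunct2]
  show "t \<in> ((x, y) \<^bold>\<in> R) \<Longrightarrow> t \<in> (x \<^bold>\<in> X)" "t \<in> ((x, y) \<^bold>\<in> R) \<Longrightarrow> t \<in> (y \<^bold>\<in> Y)"
    using D[THEN conjunct1] assms(2) by blast+
  note D = D[THEN conjunct2]
  show "t \<in> (x \<^bold>\<in> X) \<Longrightarrow> \<exists>u y. (u, t) \<in> r \<and> u \<in> ((x, y) \<^bold>\<in> R)"
    by (rule D[THEN conjunct1, rule_format, OF assms(2)])
  note D = D[THEN conjunct2]
  show "t \<in> (y \<^bold>\<in> Y) \<Longrightarrow> \<exists>u x. (u, t) \<in> r \<and> u \<in> ((x, y) \<^bold>\<in> R)"
    by (rule D[THEN conjunct1, rule_format, OF assms(2)])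
  note D = D[THEN conjunct2]
  show "t \<in> ((x, y) \<^bold>\<in> R) \<Longrightarrow> t \<in> ((x, y') \<^bold>\<in> R) \<Longrightarrow> y = y'"
    by (rule D[THEN conjunct1, rule_format, OF assms(2)])
  show "t \<in> ((x, y) \<^bold>\<in> R) \<Longrightarrow> t \<in> ((x', y) \<^bold>\<in> R) \<Longrightarrow> x = x'"
    by (rule D[THEN conjunct2, rule_format, OF assms(2)])
qed

lemma mem_mono: "p \<in> (a \<^bold>\<in> X) \<Longrightarrow> (q, p) \<in> r \<Longrightarrow> q \<in> (a \<^bold>\<in> X)"
  by (rule regularD_mono[OF regular_mem])

lemma forces_id: "p \<in> (a \<^bold>= b) \<longleftrightarrow> p \<in> Field r \<and> a = b"
  unfolding f_id_def by blast

text \<open>The density inside the existential is absorbed: \<open>q\<close> already ranges over all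
  conditions below \<open>p\<close>, and \<open>\<phi>\<close> passes to stronger
  conditions.\<close>

lemma forces_imp_ex:
  assumes "regular \<phi>" "\<And>y. regular (\<psi> y)"
  shows "p \<in> (\<phi> \<^bold>\<longrightarrow> (\<^bold>\<exists>y. \<psi> y)) \<longleftrightarrow>
    p \<in> Field r \<and> (\<forall>q. (q, p) \<in> r \<longrightarrow> q \<in> \<phi> \<longrightarrow> (\<exists>s y. (s, q) \<in> r \<and> s \<in> \<psi> y))"
    (is "_ \<longleftrightarrow> _ \<and> ?R")
proof -
  have "(\<forall>q. (q, p) \<in> r \<longrightarrow> q \<in> \<phi> \<longrightarrow> q \<in> (\<^bold>\<exists>y. \<psi> y)) \<longleftrightarrow> ?R"
  proof (intro iffI allI impI)
    fix q assume "\<forall>q. (q, p) \<in> r \<longrightarrow> q \<in> \<phi> \<longrightarrow> q \<in> (\<^bold>\<exists>y. \<psi> y)" "(q, p) \<in> r" "q \<in> \<phi>"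
    then have "q \<in> (\<^bold>\<exists>y. \<psi> y)" by blast
    then show "\<exists>s y. (s, q) \<in> r \<and> s \<in> \<psi> y" using le_refl unfolding forces_ex by blast
  next
    fix q assume R: ?R and q: "(q, p) \<in> r" "q \<in> \<phi>"
    have "\<exists>s y. (s, t) \<in> r \<and> s \<in> \<psi> y" if "(t, q) \<in> r" for t
      using R le_trans[OF that q(1)] regularD_mono[OF assms(1) q(2) that] by blast
    then show "q \<in> (\<^bold>\<exists>y. \<psi> y)" unfolding forces_ex using FieldI1[OF q(1)] by blast
  qed
  then show ?thesis using assms by (simp add: forces_imp)
qed

lemma forces_eqpoll:
  "p \<in> (X \<^bold>\<approx> Y) \<longleftrightarrow>
    p \<in> Field r \<and> (\<forall>q. (q, p) \<in> r \<longrightarrow> (\<exists>s R. (s, q) \<in> r \<and> bij_name s R X Y))"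
proof -
  have "s \<in>
      ((\<^bold>\<forall>x y. (x, y) \<^bold>\<in> R \<^bold>\<longrightarrow> x \<^bold>\<in> X \<^bold>\<and> y \<^bold>\<in> Y) \<^bold>\<and>
      (\<^bold>\<forall>x. x \<^bold>\<in> X \<^bold>\<longrightarrow> (\<^bold>\<exists>y. (x, y) \<^bold>\<in> R)) \<^bold>\<and>
      (\<^bold>\<forall>y. y \<^bold>\<in> Y \<^bold>\<longrightarrow> (\<^bold>\<exists>x. (x, y) \<^bold>\<in> R)) \<^bold>\<and>
      (\<^bold>\<forall>x y y'. (x, y) \<^bold>\<in> R \<^bold>\<and> (x, y') \<^bold>\<in> R \<^bold>\<longrightarrow> y \<^bold>= y') \<^bold>\<and>
      (\<^bold>\<forall>x x' y. (x, y) \<^bold>\<in> R \<^bold>\<and> (x', y) \<^bold>\<in> R \<^bold>\<longrightarrow> x \<^bold>= x'))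
    \<longleftrightarrow> bij_name s R X Y" for s R
    unfolding bij_name_def forces_and forces_all
    by (simp add: forces_imp_ex) (auto simp: forces_imp forces_and forces_id intro: FieldI1)
  then show ?thesis unfolding f_eqpoll_def forces_ex by simp
qed

text \<open>The possible elements of \<open>X\<close> below \<open>p\<close>: thus \<open>p\<close> forces \<open>X \<subseteq> A\<close>, for \<open>A\<close> in the
  ground model, iff \<open>poss X p \<subseteq> A\<close>.\<close>

definition poss :: "('a, 'c) name \<Rightarrow> 'c \<Rightarrow> 'a set"
  where "poss X p = {a. \<exists>q. (q, p) \<in> r \<and> q \<in> (a \<^bold>\<in> X)}"

lemma poss_mono: "(q, p) \<in> r \<Longrightarrow> poss X q \<subseteq> poss X p"
  unfolding poss_def using le_trans by blast

lemma poss_check: "p \<in> Field r \<Longrightarrow> poss (check A) p = A"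
  unfolding poss_def forces_mem_check using le_refl by blast

lemma poss_inter_check: "poss (X \<^bold>\<inter> check A) p = poss X p \<inter> A"
  unfolding poss_def forces_mem_inter forces_mem_check by (auto intro: FieldI1)

lemma poss_check_inter: "poss (check A \<^bold>\<inter> X) p = A \<inter> poss X p"
  unfolding poss_def forces_mem_inter forces_mem_check by (auto intro: FieldI1)

text \<open>Every condition has an extension deciding one given membership; finitely many successive
  extensions treat all of \<open>A\<close>.\<close>

lemma decide_mem:
  assumes "finite A" "p \<in> Field r"
  obtains q where "(q, p) \<in> r" "\<And>a. a \<in> A \<Longrightarrow> q \<in> (a \<^bold>\<in> X) \<or> q \<in> (\<^bold>\<not> a \<^bold>\<in> X)"
proof -
  from assms(1) have "\<exists>q. (q, p) \<in> r \<and> (\<forall>a\<in>A. q \<in> (a \<^bold>\<in> X) \<or> q \<in> (\<^bold>\<not> a \<^bold>\<in> X))"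
  proof induction
    case empty
    then show ?case using le_refl[OF assms(2)] by blast
  next
    case (insert b A)
    then obtain q where q: "(q, p) \<in> r" "\<forall>a\<in>A. q \<in> (a \<^bold>\<in> X) \<or> q \<in> (\<^bold>\<not> a \<^bold>\<in> X)" by blast
    obtain s where s: "(s, q) \<in> r" "s \<in> (b \<^bold>\<in> X) \<or> s \<in> (\<^bold>\<not> b \<^bold>\<in> X)"
      using le_refl[OF FieldI1[OF q(1)]] FieldI1[OF q(1)] unfolding forces_not by blast
    have "s \<in> (a \<^bold>\<in> X) \<or> s \<in> (\<^bold>\<not> a \<^bold>\<in> X)" if "a \<in> A" for a
      using q(2) that mem_mono[OF _ s(1)] regularD_mono[OF regular_not[OF regular_mem] _ s(1)] by metis
    with s le_trans[OF s(1) q(1)] show ?case by blast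
  qed
  then show ?thesis using that by blast
qed

text \<open>When all memberships in \<open>X\<close> are settled below \<open>s\<close> in agreement
  with the ground model set \<open>A\<close>, the graph of a ground model bijection names a
  bijection in the extension.\<close>

lemma bij_name_check:
  assumes "s \<in> Field r" "bij_betw f A B" "\<And>t a. (t, s) \<in> r \<Longrightarrow> t \<in> (a \<^bold>\<in> X) \<longleftrightarrow> a \<in> A"
  shows "bij_name s (check ((\<lambda>a. (a, f a)) ` A)) X (check B)"
  unfolding bij_name_def forces_mem_check
proof (intro conjI allI impI)
  fix t assume t: "(t, s) \<in> r"
  note tF = FieldI1[OF t]
  show "\<exists>u y. (u, t) \<in> r \<and> u \<in> Field r \<and> (x, y) \<in> (\<lambda>a. (a, f a)) ` A" if "t \<in> (x \<^bold>\<in> X)" for x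
    using that assms(3)[OF t] le_refl[OF tF] tF by blast
  show "\<exists>u x. (u, t) \<in> r \<and> u \<in> Field r \<and> (x, y) \<in> (\<lambda>a. (a, f a)) ` A"
    if "t \<in> Field r \<and> y \<in> B" for y
    using that assms(2) le_refl[OF tF] tF unfolding bij_betw_def by blast
  show "t \<in> (x \<^bold>\<in> X)" "t \<in> Field r" "y \<in> B"
    if "t \<in> Field r \<and> (x, y) \<in> (\<lambda>a. (a, f a)) ` A" for x y
    using that assms(2) assms(3)[OF t] unfolding bij_betw_def by auto
  show "y = y'" if "t \<in> Field r \<and> (x, y) \<in> (\<lambda>a. (a, f a)) ` A"
    "t \<in> Field r \<and> (x, y') \<in> (\<lambda>a. (a, f a)) ` A" for x y y' using that by blast
  show "x = x'" if "t \<in> Field r \<and> (x, y) \<in> (\<lambda>a. (a, f a)) ` A"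
    "t \<in> Field r \<and> (x', y) \<in> (\<lambda>a. (a, f a)) ` A" for x x' y
    using that assms(2) unfolding bij_betw_def inj_on_def by auto
qed (rule assms(1))

section \<open>Finiteness and size in the extension\<close>

lemma forces_finite:
  "p \<in> f_finite X \<longleftrightarrow> p \<in> Field r \<and> (\<forall>q. (q, p) \<in> r \<longrightarrow> (\<exists>s. (s, q) \<in> r \<and> finite (poss X s)))"
proof -
  \<comment> \<open>A forced bijection with the first \<open>n\<close> naturals enumerates
    \<open>X\<close>. Deciding its \<open>n\<close> values one after another leaves no other
    possible elements.\<close>
  have "\<exists>t. (t, s) \<in> r \<and> finite (poss X t)" if s: "s \<in> (X \<^bold>\<approx> check {..<n::nat})" for s n
  proof -
    obtain t R where t: "(t, s) \<in> r" and R: "bij_name t R X (check {..<n})"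
      using s le_refl unfolding forces_eqpoll by blast
    have tF: "t \<in> Field r" using t by (rule FieldI1)
    have "\<exists>u g. (u, t) \<in> r \<and> (\<forall>i<m. u \<in> ((g i, i) \<^bold>\<in> R))" if "m \<le> n" for m
      using that
    proof (induction m)
      case 0
      then show ?case using le_refl[OF tF] by blast
    next
      case (Suc m)
      then obtain u g where u: "(u, t) \<in> r" "\<forall>i<m. u \<in> ((g i, i) \<^bold>\<in> R)" by auto
      have "u \<in> (m \<^bold>\<in> check {..<n})" using Suc.prems FieldI1[OF u(1)] by (simp add: forces_mem_check)
      then obtain v x where v: "(v, u) \<in> r" "v \<in> ((x, m) \<^bold>\<in> R)"
        using bij_nameD(4)[OF R u(1)] by blast
      have "v \<in> (((g(m := x)) i, i) \<^bold>\<in> R)" if "i < Suc m" for i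
        using that v(2) mem_mono[of u "(g i, i)" R, OF _ v(1)] u(2) by (cases "i = m") (auto simp: less_Suc_eq)
      then show ?case using le_trans[OF v(1) u(1)] by blast
    qed
    from this[of n] obtain u g where u: "(u, t) \<in> r" "\<forall>i<n. u \<in> ((g i, i) \<^bold>\<in> R)" by auto
    \<comment> \<open>Below some \<open>w\<close> a possible element \<open>a\<close> acquires an
      index \<open>i < n\<close>, whose value is already decided as \<open>g i\<close>; injectivity
      of the enumeration yields \<open>a = g i\<close>.\<close>
    have "poss X u \<subseteq> g ` {..<n}"
    proof
      fix a assume "a \<in> poss X u"
      then obtain v where v: "(v, u) \<in> r" "v \<in> (a \<^bold>\<in> X)" unfolding poss_def by blast
      then have vt: "(v, t) \<in> r" using u(1) le_trans by blast
      from bij_nameD(3)[OF R this v(2)] obtain w i where w: "(w, v) \<in> r" "w \<in> ((a, i) \<^bold>\<in> R)" by blast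
      have wt: "(w, t) \<in> r" "(w, u) \<in> r" using w(1) vt v(1) le_trans by blast+
      from bij_nameD(2)[OF R wt(1) w(2)] have "w \<in> (i \<^bold>\<in> check {..<n})" .
      then have "i < n" unfolding forces_mem_check by simp
      then have "w \<in> ((g i, i) \<^bold>\<in> R)" using u(2) mem_mono[of u "(g i, i)" R w] wt(2) by simp
      then have "a = g i" by (rule bij_nameD(6)[OF R wt(1) w(2)])
      then show "a \<in> g ` {..<n}" using \<open>i < n\<close> by blast
    qed
    then have "finite (poss X u)" by (rule finite_subset) simp
    then show ?thesis using u(1) t le_trans by blast
  qed
  \<comment> \<open>Conversely, deciding the finitely many possible elements identifies
    \<open>X\<close> with a finite ground model set \<open>A\<close>, which is counted in the ground
    model.\<close>
  moreover have "\<exists>t. (t, s) \<in> r \<and> (\<exists>n::nat. t \<in> (X \<^bold>\<approx> check {..<n}))"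
    if fin: "finite (poss X s)" and s: "s \<in> Field r" for s
  proof -
    obtain t where t: "(t, s) \<in> r" "\<And>a. a \<in> poss X s \<Longrightarrow> t \<in> (a \<^bold>\<in> X) \<or> t \<in> (\<^bold>\<not> a \<^bold>\<in> X)"
      using decide_mem[OF fin s] by metis
    define A where "A = {a \<in> poss X s. t \<in> (a \<^bold>\<in> X)}"
    have "finite A" unfolding A_def using fin by simp
    then obtain f where f: "bij_betw f A {..<card A}"
      using ex_bij_betw_finite_nat by (metis atLeast0LessThan)
    have A: "u \<in> (a \<^bold>\<in> X) \<longleftrightarrow> a \<in> A" if u: "(u, t) \<in> r" for u a
    proof
      assume "u \<in> (a \<^bold>\<in> X)"
      moreover from this have "a \<in> poss X s" unfolding poss_def using le_trans[OF u t(1)] by blast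
      ultimately show "a \<in> A" using t(2) u unfolding A_def forces_not by blast
    qed (use mem_mono[OF _ u] in \<open>auto simp: A_def\<close>)
    have "u \<in> (X \<^bold>\<approx> check {..<card A})" if u: "(u, t) \<in> r" for u
      unfolding forces_eqpoll
    proof (intro conjI allI impI)
      show "u \<in> Field r" using u by (rule FieldI1)
      fix q assume q: "(q, u) \<in> r"
      have "bij_name q (check ((\<lambda>a. (a, f a)) ` A)) X (check {..<card A})"
        using FieldI1[OF q] f A le_trans[OF _ le_trans[OF q u]] by (intro bij_name_check) blast+
      then show "\<exists>s R. (s, q) \<in> r \<and> bij_name s R X (check {..<card A})"
        using le_refl[OF FieldI1[OF q]] by blast
    qed
    then show ?thesis using t(1) le_refl[OF FieldI1[OF t(1)]] by blast
  qed
  ultimately have "(\<exists>s n. (s, q) \<in> r \<and> s \<in> (X \<^bold>\<approx> check {..<n::nat})) \<longleftrightarrow>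
      (\<exists>s. (s, q) \<in> r \<and> finite (poss X s))" for q
    using le_trans FieldI1 by meson
  then show ?thesis unfolding f_finite_def forces_ex by simp
qed

text \<open>Having finitely many possible elements passes to stronger conditions, so a single
  condition with this property already forces finiteness.\<close>

lemma forces_infinite:
  "p \<in> (\<^bold>\<not> f_finite X) \<longleftrightarrow> p \<in> Field r \<and> (\<forall>q. (q, p) \<in> r \<longrightarrow> infinite (poss X q))"
proof -
  have "q \<in> f_finite X" if "finite (poss X q)" "q \<in> Field r" for q
    unfolding forces_finite using that le_refl finite_subset[OF poss_mono] by (blast intro: FieldI1)
  moreover have "\<exists>s. (s, q) \<in> r \<and> finite (poss X s)" if "q \<in> f_finite X" for q
    using that le_refl unfolding forces_finite by blast
  ultimately show ?thesis unfolding forces_not using le_trans FieldI1 by meson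
qed

text \<open>Otherwise every index \<open>y\<close> has a condition \<open>u y\<close> forcing some
  \<open>x y \<in> S\<close> to be its partner. The pair \<open>(x y, u y)\<close> determines
  \<open>y\<close>, so the continuum would inject into \<open>S \<times> Field r\<close>, which is
  too small because the forcing is countable.\<close>

lemma eqpoll_continuum_avoids_small:
  assumes "countable (Field r)" "p \<in> (\<B> \<^bold>\<approx> check continuum)" "S \<prec> continuum"
  obtains q x where "(q, p) \<in> r" "x \<notin> S" "q \<in> (x \<^bold>\<in> \<B>)"
proof (rule ccontr)
  assume neg: "\<not> thesis"
  obtain s R where s: "(s, p) \<in> r" and R: "bij_name s R \<B> (check continuum)"
    using assms(2) le_refl unfolding forces_eqpoll by blast
  have "\<exists>u x. (u, s) \<in> r \<and> u \<in> ((x, y) \<^bold>\<in> R)" for y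
  proof -
    have "s \<in> (y \<^bold>\<in> check continuum)" unfolding forces_mem_check using FieldI1[OF s] by simp
    then show ?thesis by (rule bij_nameD(4)[OF R le_refl[OF FieldI1[OF s]]])
  qed
  then obtain u x where ux: "\<And>y. (u y, s) \<in> r" "\<And>y. u y \<in> ((x y, y) \<^bold>\<in> R)" by metis
  have "x y \<in> S" for y
  proof (rule ccontr)
    assume "x y \<notin> S"
    moreover have "u y \<in> (x y \<^bold>\<in> \<B>)" by (rule bij_nameD(1)[OF R ux])
    ultimately have thesis by (rule that[OF le_trans[OF ux(1) s]])
    with neg show False ..
  qed
  then have "(\<lambda>y. (x y, u y)) ` continuum \<subseteq> S \<times> Field r" using FieldI1[OF ux(1)] by blast
  moreover have "inj (\<lambda>y. (x y, u y))"
  proof (rule injI)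
    fix y y' assume "(x y, u y) = (x y', u y')"
    then have "u y \<in> ((x y, y') \<^bold>\<in> R)" using ux(2)[of y'] by simp
    then show "y = y'" by (rule bij_nameD(5)[OF R ux])
  qed
  ultimately have "continuum \<lesssim> S \<times> Field r" unfolding lepoll_def by blast
  also have "S \<times> Field r \<prec> continuum"
    by (rule Times_countable_lesspoll_continuum) (fact assms)+
  finally show False by simp
qed

lemma ex_finite_poss: "p \<in> f_finite X \<Longrightarrow> \<exists>q. (q, p) \<in> r \<and> finite (poss X q)"
  using le_refl unfolding forces_finite by blast

lemma ex_finite_poss_family:
  assumes "finite I" "p \<in> Field r" "\<And>i. i \<in> I \<Longrightarrow> p \<in> f_finite (X i)"
  shows "\<exists>q. (q, p) \<in> r \<and> (\<forall>i\<in>I. finite (poss (X i) q))"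
  using assms(1,3)
proof (induction I)
  case empty
  then show ?case using le_refl[OF assms(2)] by blast
next
  case (insert j I)
  then obtain q where q: "(q, p) \<in> r" "\<forall>i\<in>I. finite (poss (X i) q)" by blast
  have "q \<in> f_finite (X j)" using regularD_mono[OF regular_finite insert.prems q(1)] by blast
  then obtain s where s: "(s, q) \<in> r" "finite (poss (X j) s)" using ex_finite_poss by blast
  have "finite (poss (X i) s)" if "i \<in> I" for i
    using q(2) that finite_subset[OF poss_mono[OF s(1)]] by blast
  with s(2) le_trans[OF s(1) q(1)] show ?case by blast
qed

lemma forces_finite_check: "finite A \<Longrightarrow> p \<in> Field r \<Longrightarrow> p \<in> f_finite (check A)"
  unfolding forces_finite using le_refl FieldI1 poss_check by metis

lemma forces_exI: "p \<in> \<phi> x \<Longrightarrow> regular (\<phi> x) \<Longrightarrow> p \<in> (\<^bold>\<exists>x. \<phi> x)"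
  unfolding forces_ex using regularD_mono regularD_Field le_refl FieldI1 by meson

lemma forces_eq_refl: "p \<in> Field r \<Longrightarrow> p \<in> (X \<^bold>\<equiv> X)"
  unfolding f_eq_def forces_and forces_subset by blast

lemma poss_eq: "p \<in> (X \<^bold>\<equiv> Y) \<Longrightarrow> poss X p = poss Y p"
  unfolding f_eq_def forces_and forces_subset poss_def by blast

lemma forces_eq_trans: "p \<in> (X \<^bold>\<equiv> Z) \<Longrightarrow> p \<in> (Y \<^bold>\<equiv> Z) \<Longrightarrow> p \<in> (X \<^bold>\<equiv> Y)"
  unfolding f_eq_def forces_and forces_subset by blast

section \<open>The ideal and the orthogonal in the extension\<close>

lemma forces_in_ideal:
  "p \<in> f_in_ideal Y \<G> \<longleftrightarrow> p \<in> Field r \<and> (\<forall>q. (q, p) \<in> r \<longrightarrow>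
    (\<exists>s H. (s, q) \<in> r \<and> finite H \<and> (\<forall>X\<in>H. s \<in> (X \<^bold>\<in> \<G>)) \<and> finite (poss Y s - \<Union>H)))"
proof -
  define body where "body \<H> E =
      (f_finite \<H> \<^bold>\<and> \<H> \<^bold>\<subseteq> \<G> \<^bold>\<and> f_finite E \<^bold>\<and>
      (\<^bold>\<forall>t. t \<^bold>\<in> Y \<^bold>\<longrightarrow> (\<^bold>\<exists>X. X \<^bold>\<in> \<H> \<^bold>\<and> t \<^bold>\<in> check X) \<^bold>\<or> t \<^bold>\<in> E))" for \<H> E
  have regb: "regular (body \<H> E)" for \<H> E unfolding body_def by simp
  have body: "s \<in> body \<H> E \<longleftrightarrow> s \<in> f_finite \<H> \<and> s \<in> (\<H> \<^bold>\<subseteq> \<G>) \<and> s \<in> f_finite E \<and>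
      (\<forall>t q. (q, s) \<in> r \<longrightarrow> q \<in> (t \<^bold>\<in> Y) \<longrightarrow>
        q \<in> ((\<^bold>\<exists>X. X \<^bold>\<in> \<H> \<^bold>\<and> t \<^bold>\<in> check X) \<^bold>\<or> t \<^bold>\<in> E))" for s \<H> E
    unfolding body_def forces_and forces_all
    using regularD_Field[OF regular_finite] by (auto simp: forces_imp)
  have ideal: "f_in_ideal Y \<G> = (\<^bold>\<exists>\<H> E. body \<H> E)" unfolding f_in_ideal_def body_def ..
  \<comment> \<open>Extensions of \<open>s\<close> bound the possible members of \<open>\<H>\<close>
    and the possible elements of \<open>E\<close> by finite sets and then decide the former. This
    replaces both names by ground model sets.\<close>
  have "\<exists>w H. (w, s) \<in> r \<and> finite H \<and> (\<forall>X\<in>H. w \<in> (X \<^bold>\<in> \<G>)) \<and> finite (poss Y w - \<Union>H)"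
    if s: "s \<in> body \<H> E" for s \<H> E
  proof -
    obtain t where t: "(t, s) \<in> r" "finite (poss \<H> t)" using s ex_finite_poss unfolding body by blast
    have "t \<in> f_finite E" using s t(1) regularD_mono[OF regular_finite] unfolding body by blast
    then obtain u where u: "(u, t) \<in> r" "finite (poss E u)" using ex_finite_poss by blast
    obtain w where w: "(w, u) \<in> r" "\<And>X. X \<in> poss \<H> t \<Longrightarrow> w \<in> (X \<^bold>\<in> \<H>) \<or> w \<in> (\<^bold>\<not> X \<^bold>\<in> \<H>)"
      using decide_mem[OF t(2) FieldI1[OF u(1)]] by metis
    have wt: "(w, t) \<in> r" and ws: "(w, s) \<in> r" using w(1) u(1) t(1) le_trans by blast+
    define H where "H = {X \<in> poss \<H> t. w \<in> (X \<^bold>\<in> \<H>)}"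
    have "w \<in> (X \<^bold>\<in> \<G>)" if "X \<in> H" for X
      using that s ws unfolding body forces_subset H_def by blast
    \<comment> \<open>Anything forced into \<open>\<H>\<close> below \<open>w\<close> already
      belongs to \<open>H\<close>, so a possible element of \<open>Y\<close> outside
      \<open>\<Union>H\<close> can only be placed into \<open>E\<close>.\<close>
    moreover have "poss Y w - \<Union>H \<subseteq> poss E u"
    proof
      fix a assume a: "a \<in> poss Y w - \<Union>H"
      then obtain v where v: "(v, w) \<in> r" "v \<in> (a \<^bold>\<in> Y)" unfolding poss_def by blast
      have "v \<in> ((\<^bold>\<exists>X. X \<^bold>\<in> \<H> \<^bold>\<and> a \<^bold>\<in> check X) \<^bold>\<or> a \<^bold>\<in> E)"
        using s v(2) le_trans[OF v(1) ws] unfolding body by blast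
      then obtain v' where v': "(v', v) \<in> r" "v' \<in> (\<^bold>\<exists>X. X \<^bold>\<in> \<H> \<^bold>\<and> a \<^bold>\<in> check X) \<or> v' \<in> (a \<^bold>\<in> E)"
        using le_refl[OF FieldI1[OF v(1)]] unfolding forces_or by blast
      have v'w: "(v', w) \<in> r" using v'(1) v(1) le_trans by blast
      show "a \<in> poss E u"
        using v'(2)
      proof
        assume "v' \<in> (\<^bold>\<exists>X. X \<^bold>\<in> \<H> \<^bold>\<and> a \<^bold>\<in> check X)"
        then obtain x X where x: "(x, v') \<in> r" "x \<in> (X \<^bold>\<in> \<H>)" "a \<in> X"
          using le_refl[OF FieldI1[OF v'(1)]] unfolding forces_ex forces_and forces_mem_check by blast
        have xw: "(x, w) \<in> r" using x(1) v'w le_trans by blast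
        then have X: "X \<in> poss \<H> t" unfolding poss_def using x(2) le_trans[OF _ wt] by blast
        have "w \<notin> (\<^bold>\<not> X \<^bold>\<in> \<H>)" using xw x(2) unfolding forces_not by blast
        then have "X \<in> H" using X w(2) unfolding H_def by blast
        then show ?thesis using a x(3) by blast
      next
        assume "v' \<in> (a \<^bold>\<in> E)"
        then show ?thesis unfolding poss_def using le_trans[OF v'w w(1)] by blast
      qed
    qed
    then have "finite (poss Y w - \<Union>H)" using u(2) by (rule finite_subset)
    moreover have "finite H" unfolding H_def using t(2) by simp
    ultimately show ?thesis using ws by blast
  qed
  \<comment> \<open>Conversely, the check names of \<open>H\<close> and of the finite uncovered
    remainder are witnesses at the same condition.\<close>
  moreover have "s \<in> body (check H) (check (poss Y s - \<Union>H))"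
    if s: "s \<in> Field r" and H: "finite H" "\<forall>X\<in>H. s \<in> (X \<^bold>\<in> \<G>)" "finite (poss Y s - \<Union>H)" for s H
    unfolding body
  proof (intro conjI allI impI)
    show "s \<in> f_finite (check H)" "s \<in> f_finite (check (poss Y s - \<Union>H))"
      using s H forces_finite_check by blast+
    show "s \<in> (check H \<^bold>\<subseteq> \<G>)"
      unfolding forces_subset forces_mem_check using s mem_mono[OF H(2)[rule_format]] by simp
    fix t q assume q: "(q, s) \<in> r" "q \<in> (t \<^bold>\<in> Y)"
    then have t: "t \<in> poss Y s" unfolding poss_def by blast
    have qF: "q \<in> Field r" using q(1) by (rule FieldI1)
    show "q \<in> ((\<^bold>\<exists>X. X \<^bold>\<in> check H \<^bold>\<and> t \<^bold>\<in> check X) \<^bold>\<or> t \<^bold>\<in> check (poss Y s - \<Union>H))"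
      unfolding forces_or
    proof (intro conjI allI impI qF)
      fix q' assume "(q', q) \<in> r"
      then have q': "q' \<in> Field r" by (rule FieldI1)
      show "\<exists>u. (u, q') \<in> r \<and> (u \<in> (\<^bold>\<exists>X. X \<^bold>\<in> check H \<^bold>\<and> t \<^bold>\<in> check X) \<or>
          u \<in> (t \<^bold>\<in> check (poss Y s - \<Union>H)))"
      proof (intro exI[of _ q'] conjI le_refl q')
        show "q' \<in> (\<^bold>\<exists>X. X \<^bold>\<in> check H \<^bold>\<and> t \<^bold>\<in> check X) \<or> q' \<in> (t \<^bold>\<in> check (poss Y s - \<Union>H))"
        proof (cases "t \<in> \<Union>H")
          case True
          then obtain X where "X \<in> H" "t \<in> X" by blast
          then have "q' \<in> (X \<^bold>\<in> check H \<^bold>\<and> t \<^bold>\<in> check X)"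
            using q' unfolding forces_and forces_mem_check by blast
          then have "q' \<in> (\<^bold>\<exists>X. X \<^bold>\<in> check H \<^bold>\<and> t \<^bold>\<in> check X)" by (rule forces_exI) simp
          then show ?thesis ..
        qed (use t q' in \<open>simp add: forces_mem_check\<close>)
      qed
    qed
  qed
  ultimately have "(\<exists>s \<H> E. (s, q) \<in> r \<and> s \<in> body \<H> E) \<longleftrightarrow>
      (\<exists>s H. (s, q) \<in> r \<and> finite H \<and> (\<forall>X\<in>H. s \<in> (X \<^bold>\<in> \<G>)) \<and> finite (poss Y s - \<Union>H))" for q
    using le_trans FieldI1 by meson
  \<comment> \<open>Two nested existential name quantifiers, each asserting density, amount to one
    dense choice of both names.\<close>
  moreover have "(\<exists>s \<H>. (s, q) \<in> r \<and> s \<in> (\<^bold>\<exists>E. body \<H> E)) \<longleftrightarrow> (\<exists>s \<H> E. (s, q) \<in> r \<and> s \<in> body \<H> E)" for q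
  proof
    assume "\<exists>s \<H>. (s, q) \<in> r \<and> s \<in> (\<^bold>\<exists>E. body \<H> E)"
    then obtain s \<H> where "(s, q) \<in> r" "s \<in> (\<^bold>\<exists>E. body \<H> E)" by blast
    moreover from this obtain t E where "(t, s) \<in> r" "t \<in> body \<H> E"
      unfolding forces_ex using le_refl by blast
    ultimately show "\<exists>s \<H> E. (s, q) \<in> r \<and> s \<in> body \<H> E" using le_trans by blast
  next
    assume "\<exists>s \<H> E. (s, q) \<in> r \<and> s \<in> body \<H> E"
    then obtain s \<H> E where s: "(s, q) \<in> r" "s \<in> body \<H> E" by blast
    from s(2) have "s \<in> (\<^bold>\<exists>E. body \<H> E)" by (rule forces_exI) (rule regb)
    with s(1) show "\<exists>s \<H>. (s, q) \<in> r \<and> s \<in> (\<^bold>\<exists>E. body \<H> E)" by blast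
  qed
  ultimately show ?thesis unfolding ideal forces_ex[of _ "\<lambda>\<H>. \<^bold>\<exists>E. body \<H> E"] by simp
qed

lemma forces_in_perp:
  "p \<in> f_in_perp Y \<B> \<longleftrightarrow> p \<in> (\<^bold>\<not> f_finite Y) \<and>
    (\<forall>X q. (q, p) \<in> r \<longrightarrow> q \<in> (X \<^bold>\<in> \<B>) \<longrightarrow> q \<in> f_finite (check X \<^bold>\<inter> Y))"
  unfolding f_in_perp_def forces_and forces_all by (auto simp: forces_imp forces_not)

lemma forces_ad_family:
  "p \<in> f_ad_family \<G> \<longleftrightarrow> p \<in> Field r \<and>
    (\<forall>q X. (q, p) \<in> r \<longrightarrow> q \<in> (X \<^bold>\<in>\<^bold>\<in> \<G>) \<longrightarrow> q \<in> (\<^bold>\<not> f_finite X)) \<and>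
    (\<forall>q X Y. (q, p) \<in> r \<longrightarrow> q \<in> (X \<^bold>\<in>\<^bold>\<in> \<G>) \<longrightarrow> q \<in> (Y \<^bold>\<in>\<^bold>\<in> \<G>) \<longrightarrow> q \<in> (\<^bold>\<not> X \<^bold>\<equiv> Y) \<longrightarrow>
      q \<in> f_finite (X \<^bold>\<inter> Y))"
  unfolding f_ad_family_def forces_and forces_all by (auto simp: forces_imp forces_and)

section \<open>Almost decidedness in the extension\<close>

lemma in_perp_imp_in_ideal:
  assumes cnt: "countable (Field r)"
    and S: "S \<prec> continuum" "\<And>X p. X \<in> F - S \<Longrightarrow> p \<in> Field r \<Longrightarrow>
      infinite (X \<inter> poss Y p) \<or> (\<exists>H. finite H \<and> H \<subseteq> F \<and> finite (poss Y p - \<Union>H))"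
    and sub: "p \<in> (\<B> \<^bold>\<subseteq> check F)" and eqp: "p \<in> (\<B> \<^bold>\<approx> check continuum)" and perp: "p \<in> f_in_perp Y \<B>"
  shows "p \<in> f_in_ideal Y (check F \<^bold>- \<B>)"
  unfolding forces_in_ideal
proof (intro conjI allI impI)
  show "p \<in> Field r" using regularD_Field[OF regular_eqpoll eqp] .
  have perpD: "q \<in> f_finite (check X \<^bold>\<inter> Y)" if "(q, p) \<in> r" "q \<in> (X \<^bold>\<in> \<B>)" for q X
    using perp that unfolding forces_in_perp by blast
  fix q assume q: "(q, p) \<in> r"
  \<comment> \<open>The exceptional set \<open>S\<close> serves all conditions at once. So
    \<open>X\<close> in \<open>\<B>\<close> can be chosen outside \<open>S\<close> first, and the
    condition strengthened afterwards to bound the trace of \<open>Y\<close> on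
    \<open>X\<close>.\<close>
  obtain t X where t: "(t, q) \<in> r" "X \<notin> S" "t \<in> (X \<^bold>\<in> \<B>)"
    using eqpoll_continuum_avoids_small[OF cnt regularD_mono[OF regular_eqpoll eqp q] S(1)] .
  have tp: "(t, p) \<in> r" using t(1) q by (rule le_trans)
  have "X \<in> F" using sub tp t(3) unfolding forces_subset forces_mem_check by blast
  obtain u where u: "(u, t) \<in> r" "finite (X \<inter> poss Y u)"
    using ex_finite_poss[OF perpD[OF tp t(3)]] unfolding poss_check_inter by blast
  have uF: "u \<in> Field r" using u(1) by (rule FieldI1)
  \<comment> \<open>The finite trace on \<open>X\<close> excludes the first alternative of the
    dichotomy and leaves an almost cover of \<open>poss Y u\<close>.\<close>
  obtain H where H: "finite H" "H \<subseteq> F" "finite (poss Y u - \<Union>H)"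
    using S(2)[of X u] \<open>X \<in> F\<close> t(2) uF u(2) by blast
  \<comment> \<open>The cover may contain members of \<open>\<B>\<close>. Once they are identified
    as \<open>I\<close>, orthogonality lets a further extension \<open>w\<close> make their traces
    on \<open>poss Y w\<close> finite.\<close>
  obtain v where v: "(v, u) \<in> r" "\<And>Z. Z \<in> H \<Longrightarrow> v \<in> (Z \<^bold>\<in> \<B>) \<or> v \<in> (\<^bold>\<not> Z \<^bold>\<in> \<B>)"
    using decide_mem[OF H(1) uF] by metis
  have vp: "(v, p) \<in> r" using le_trans[OF v(1) le_trans[OF u(1) tp]] .
  define I where "I = {Z \<in> H. v \<in> (Z \<^bold>\<in> \<B>)}"
  have "\<exists>w. (w, v) \<in> r \<and> (\<forall>Z\<in>I. finite (poss (check Z \<^bold>\<inter> Y) w))"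
    by (rule ex_finite_poss_family) (use H(1) vp FieldI1[OF vp] perpD in \<open>auto simp: I_def\<close>)
  then obtain w where w: "(w, v) \<in> r" "\<And>Z. Z \<in> I \<Longrightarrow> finite (Z \<inter> poss Y w)"
    unfolding poss_check_inter by blast
  have "w \<in> (Z \<^bold>\<in> check F \<^bold>- \<B>)" if Z: "Z \<in> H - I" for Z
  proof -
    have "v \<in> (\<^bold>\<not> Z \<^bold>\<in> \<B>)" using v(2) Z unfolding I_def by blast
    then have "w \<in> (\<^bold>\<not> Z \<^bold>\<in> \<B>)" by (rule regularD_mono[OF regular_not[OF regular_mem] _ w(1)])
    then show ?thesis unfolding forces_mem_diff forces_mem_check using FieldI1[OF w(1)] Z H(2) by blast
  qed
  \<comment> \<open>The sets in \<open>I\<close> cover only finitely many points of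
    \<open>poss Y w\<close>, so the part of the cover forced outside \<open>\<B>\<close>
    suffices.\<close>
  moreover have "finite (poss Y w - \<Union>(H - I))"
  proof (rule finite_if_finite_Int_cover)
    show "finite I" using H(1) by (simp add: I_def)
    have "poss Y w \<subseteq> poss Y u" using poss_mono[OF le_trans[OF w(1) v(1)]] .
    then have "poss Y w - \<Union>(H - I) - \<Union>I \<subseteq> poss Y u - \<Union>H" by blast
    then show "finite (poss Y w - \<Union>(H - I) - \<Union>I)" using H(3) by (rule finite_subset)
    show "finite ((poss Y w - \<Union>(H - I)) \<inter> Z)" if "Z \<in> I" for Z
      by (rule finite_subset[OF _ w(2)[OF that]]) blast
  qed
  moreover have "(w, q) \<in> r" using le_trans[OF w(1) le_trans[OF v(1) le_trans[OF u(1) t(1)]]] .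
  ultimately show "\<exists>s H. (s, q) \<in> r \<and> finite H \<and> (\<forall>X\<in>H. s \<in> (X \<^bold>\<in> check F \<^bold>- \<B>)) \<and>
      finite (poss Y s - \<Union>H)"
    using H(1) by (intro exI[of _ w] exI[of _ "H - I"]) simp
qed

text \<open>A set \<open>X\<close> in \<open>\<B>\<close> differs from each of the finitely many
  members of \<open>F\<close> outside \<open>\<B>\<close> that almost cover \<open>Y\<close>; almost
  disjointness then leaves only a finite trace of \<open>Y\<close> on \<open>X\<close>.\<close>

lemma in_ideal_imp_in_perp:
  assumes ad: "ad_family F" and sub: "p \<in> (\<B> \<^bold>\<subseteq> check F)" and inf: "p \<in> (\<^bold>\<not> f_finite Y)"
    and ideal: "p \<in> f_in_ideal Y (check F \<^bold>- \<B>)"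
  shows "p \<in> f_in_perp Y \<B>"
  unfolding forces_in_perp
proof (intro conjI allI impI inf)
  fix X q assume q: "(q, p) \<in> r" "q \<in> (X \<^bold>\<in> \<B>)"
  then have "X \<in> F" using sub unfolding forces_subset forces_mem_check by blast
  show "q \<in> f_finite (check X \<^bold>\<inter> Y)"
    unfolding forces_finite poss_check_inter
  proof (intro conjI allI impI)
    show "q \<in> Field r" using q(1) by (rule FieldI1)
    fix t assume t: "(t, q) \<in> r"
    obtain s H where s: "(s, t) \<in> r" "finite H" "\<forall>Z\<in>H. s \<in> (Z \<^bold>\<in> check F \<^bold>- \<B>)"
        "finite (poss Y s - \<Union>H)"
      using ideal le_trans[OF t q(1)] unfolding forces_in_ideal by blast
    have "s \<in> (X \<^bold>\<in> \<B>)" using mem_mono[OF q(2) le_trans[OF s(1) t]] .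
    have FIN: "finite (X \<inter> Z)" if Z: "Z \<in> H" for Z
    proof -
      have "Z \<in> F" "s \<in> (\<^bold>\<not> Z \<^bold>\<in> \<B>)"
        using s(3) Z unfolding forces_mem_diff forces_mem_check by blast+
      moreover from this have "Z \<noteq> X"
        using \<open>s \<in> (X \<^bold>\<in> \<B>)\<close> le_refl[OF FieldI1[OF s(1)]] unfolding forces_not by blast
      ultimately show ?thesis using ad_familyD(2)[OF ad \<open>X \<in> F\<close>] by blast
    qed
    have XZ: "finite (X \<inter> poss Y s \<inter> Z)" if "Z \<in> H" for Z
      by (rule finite_subset[OF _ FIN[OF that]]) blast
    have "finite (X \<inter> poss Y s - \<Union>H)" by (rule finite_subset[OF _ s(4)]) blast
    then have "finite (X \<inter> poss Y s)" using XZ by (rule finite_if_finite_Int_cover[OF s(2)])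
    then show "\<exists>s. (s, t) \<in> r \<and> finite (X \<inter> poss Y s)" using s(1) by blast
  qed
qed

text \<open>\<open>dich\<close> is the ground model property of \<open>F\<close> applied to names,
  with one exceptional set for all conditions. The hypotheses on \<open>\<B>\<close> and
  \<open>Y\<close> pass to stronger conditions, so the equivalence can be checked at each of them
  separately.\<close>

lemma forces_almost_decided:
  assumes "countable (Field r)" "ad_family F"
    and dich: "\<And>Y :: ('a, 'c) name. \<exists>S. S \<prec> continuum \<and> (\<forall>X\<in>F - S. \<forall>p\<in>Field r.
      infinite (X \<inter> poss Y p) \<or> (\<exists>H. finite H \<and> H \<subseteq> F \<and> finite (poss Y p - \<Union>H)))"
    and "p \<in> Field r"
  shows "p \<in> f_almost_decided continuum F"
proof -
  have "q \<in> f_almost_decides \<B> F"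
    if sub: "q \<in> (\<B> \<^bold>\<subseteq> check F)" and eqp: "q \<in> (\<B> \<^bold>\<approx> check continuum)" for \<B> q
  proof -
    have "q \<in> (\<^bold>\<not> f_finite Y \<^bold>\<longrightarrow> (f_in_perp Y \<B> \<^bold>\<longleftrightarrow> f_in_ideal Y (check F \<^bold>- \<B>)))" for Y
    proof -
      obtain S where S: "S \<prec> continuum" "\<And>X p. X \<in> F - S \<Longrightarrow> p \<in> Field r \<Longrightarrow>
          infinite (X \<inter> poss Y p) \<or> (\<exists>H. finite H \<and> H \<subseteq> F \<and> finite (poss Y p - \<Union>H))"
        using dich[of Y] by blast
      have "t \<in> f_in_perp Y \<B> \<longleftrightarrow> t \<in> f_in_ideal Y (check F \<^bold>- \<B>)"
        if s: "(s, q) \<in> r" "s \<in> (\<^bold>\<not> f_finite Y)" and t: "(t, s) \<in> r" for s t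
      proof -
        have tq: "(t, q) \<in> r" using t s(1) by (rule le_trans)
        note mono = regularD_mono[OF regular_subset sub tq] regularD_mono[OF regular_eqpoll eqp tq]
          regularD_mono[OF regular_not[OF regular_finite] s(2) t]
        show ?thesis
          using in_perp_imp_in_ideal[OF assms(1) S mono(1,2)]
            in_ideal_imp_in_perp[OF assms(2) mono(1,3)] by blast
      qed
      then show ?thesis
        using regularD_Field[OF regular_subset sub] by (auto simp: forces_imp forces_iff intro: FieldI1)
    qed
    then show ?thesis
      unfolding f_almost_decides_def forces_all using regularD_Field[OF regular_subset sub] by blast
  qed
  then show ?thesis
    unfolding f_almost_decided_def forces_all using assms(4) by (simp add: forces_imp forces_and)
qed

section \<open>The family as a mad family in the extension\<close>

lemma forces_check_mem_check_fam:
  assumes "Z \<in> F" "p \<in> Field r"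
  shows "p \<in> (check Z \<^bold>\<in>\<^bold>\<in> check_fam F)"
  unfolding forces_check_fam using assms forces_eq_refl le_refl by (meson FieldI1)

text \<open>Densely often a name in the family is identified with one set \<open>Z\<close> of
  \<open>F\<close>, and then its possible elements are exactly \<open>Z\<close>. Infinity and almost
  disjointness are thus inherited from the ground model.\<close>

lemma forces_ad_family_check_fam:
  assumes ad: "ad_family F" and "p \<in> Field r"
  shows "p \<in> f_ad_family (check_fam F)"
  unfolding forces_ad_family
proof (intro conjI allI impI assms(2))
  fix q X assume q: "(q, p) \<in> r" "q \<in> (X \<^bold>\<in>\<^bold>\<in> check_fam F)"
  show "q \<in> (\<^bold>\<not> f_finite X)"
    unfolding forces_infinite
  proof (intro conjI allI impI)
    show "q \<in> Field r" using q(1) by (rule FieldI1)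
    fix s assume "(s, q) \<in> r"
    then obtain t Z where t: "(t, s) \<in> r" "Z \<in> F" "t \<in> (X \<^bold>\<equiv> check Z)"
      using q(2) unfolding forces_check_fam by blast
    then have "poss X t = Z" using poss_eq poss_check FieldI1 by metis
    then have "infinite (poss X t)" using ad_familyD(1)[OF ad t(2)] by simp
    then show "infinite (poss X s)" by (rule infinite_super[OF poss_mono[OF t(1)]])
  qed
next
  fix q X Y assume q: "(q, p) \<in> r" and X: "q \<in> (X \<^bold>\<in>\<^bold>\<in> check_fam F)" and Y: "q \<in> (Y \<^bold>\<in>\<^bold>\<in> check_fam F)"
    and ne: "q \<in> (\<^bold>\<not> X \<^bold>\<equiv> Y)"
  show "q \<in> f_finite (X \<^bold>\<inter> Y)"
    unfolding forces_finite
  proof (intro conjI allI impI)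
    show "q \<in> Field r" using q by (rule FieldI1)
    fix s assume s: "(s, q) \<in> r"
    then obtain t Z where t: "(t, s) \<in> r" "Z \<in> F" "t \<in> (X \<^bold>\<equiv> check Z)"
      using X unfolding forces_check_fam by blast
    then obtain u W where u: "(u, t) \<in> r" "W \<in> F" "u \<in> (Y \<^bold>\<equiv> check W)"
      using Y le_trans[OF t(1) s] unfolding forces_check_fam by blast
    have uX: "u \<in> (X \<^bold>\<equiv> check Z)" by (rule regularD_mono[OF regular_eq t(3) u(1)])
    have "Z \<noteq> W"
    proof
      assume "Z = W"
      then have "u \<in> (X \<^bold>\<equiv> Y)" using forces_eq_trans[OF uX] u(3) by simp
      moreover have "(u, q) \<in> r" using le_trans[OF u(1) le_trans[OF t(1) s]] .
      ultimately show False using ne unfolding forces_not by blast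
    qed
    then have "finite (Z \<inter> W)" using ad_familyD(2)[OF ad t(2) u(2)] by blast
    moreover have "poss (X \<^bold>\<inter> Y) u \<subseteq> poss X u \<inter> poss Y u"
      unfolding poss_def forces_mem_inter by blast
    moreover have "poss X u = Z" "poss Y u = W"
      using poss_eq[OF uX] poss_eq[OF u(3)] unfolding poss_check[OF FieldI1[OF u(1)]] .
    ultimately have "finite (poss (X \<^bold>\<inter> Y) u)" using finite_subset by metis
    then show "\<exists>t. (t, s) \<in> r \<and> finite (poss (X \<^bold>\<inter> Y) t)" using le_trans[OF u(1) t(1)] by blast
  qed
qed

lemma forces_mad_family_check_fam:
  fixes F :: "'a set set"
  assumes ad: "ad_family F" and cover: "\<Union>F = UNIV" and F: "F \<approx> continuum"
    and dich: "\<And>Y :: ('a, 'c) name. \<exists>S. S \<prec> continuum \<and> (\<forall>X\<in>F - S. \<forall>p\<in>Field r.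
      infinite (X \<inter> poss Y p) \<or> (\<exists>H. finite H \<and> H \<subseteq> F \<and> finite (poss Y p - \<Union>H)))"
    and p: "p \<in> Field r"
  shows "p \<in> f_mad_family (check_fam F)"
proof -
  have ex: "p \<in> (\<^bold>\<exists>X. X \<^bold>\<in>\<^bold>\<in> check_fam F \<^bold>\<and> t \<^bold>\<in> X)" for t
  proof -
    obtain Z where "Z \<in> F" "t \<in> Z" using cover by blast
    then have "p \<in> (check Z \<^bold>\<in>\<^bold>\<in> check_fam F \<^bold>\<and> t \<^bold>\<in> check Z)"
      using p forces_check_mem_check_fam unfolding forces_and forces_mem_check by blast
    then show ?thesis by (rule forces_exI) simp
  qed
  \<comment> \<open>If no extension of \<open>t\<close> identified \<open>X\<close> with a member of
    \<open>F\<close>, then \<open>X\<close> would be forced infinite and almost disjoint from all of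
    \<open>F\<close>. The dichotomy would nevertheless give a finite almost cover by members of
    \<open>F\<close>, making \<open>X\<close> finite.\<close>
  have max: "s \<in> (X \<^bold>\<in>\<^bold>\<in> check_fam F)"
    if G: "q \<in> f_ad_family \<G>" and FG: "\<And>s X. (s, q) \<in> r \<Longrightarrow> s \<in> (X \<^bold>\<in>\<^bold>\<in> check_fam F) \<Longrightarrow> s \<in> (X \<^bold>\<in>\<^bold>\<in> \<G>)"
      and s: "(s, q) \<in> r" "s \<in> (X \<^bold>\<in>\<^bold>\<in> \<G>)" for \<G> X q s
    unfolding forces_check_fam
  proof (intro conjI allI impI, rule FieldI1[OF s(1)], rule ccontr)
    fix t assume t: "(t, s) \<in> r" and neg: "\<not> (\<exists>u. (u, t) \<in> r \<and> (\<exists>Z\<in>F. u \<in> (X \<^bold>\<equiv> check Z)))"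
    have tq: "(t, q) \<in> r" using t s(1) by (rule le_trans)
    have tF: "t \<in> Field r" using t by (rule FieldI1)
    have tX: "t \<in> (X \<^bold>\<in>\<^bold>\<in> \<G>)" by (rule regularD_mono[OF regular_fam_mem s(2) t])
    have inf: "t \<in> (\<^bold>\<not> f_finite X)" using G tq tX unfolding forces_ad_family by blast
    have fin: "t \<in> f_finite (X \<^bold>\<inter> check Z)" if Z: "Z \<in> F" for Z
    proof -
      have "t \<in> (check Z \<^bold>\<in>\<^bold>\<in> \<G>)" using FG[OF tq forces_check_mem_check_fam[OF Z tF]] .
      moreover have "t \<in> (\<^bold>\<not> X \<^bold>\<equiv> check Z)" using neg Z tF unfolding forces_not by blast
      ultimately show ?thesis using G tq tX unfolding forces_ad_family by blast
    qed
    obtain S where S: "S \<prec> continuum" "\<And>Z p. Z \<in> F - S \<Longrightarrow> p \<in> Field r \<Longrightarrow>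
        infinite (Z \<inter> poss X p) \<or> (\<exists>H. finite H \<and> H \<subseteq> F \<and> finite (poss X p - \<Union>H))"
      using dich[of X] by blast
    \<comment> \<open>In the ground model \<open>F\<close> has size continuum, so a non-exceptional
      \<open>Z\<close> is available without strengthening \<open>t\<close>.\<close>
    obtain Z where Z: "Z \<in> F - S" using eqpoll_lesspoll_ex_Diff[OF F S(1)] .
    then obtain u where u: "(u, t) \<in> r" "finite (poss X u \<inter> Z)"
      using ex_finite_poss[OF fin[of Z]] unfolding poss_inter_check by blast
    obtain H where H: "finite H" "H \<subseteq> F" "finite (poss X u - \<Union>H)"
      using S(2)[OF Z FieldI1[OF u(1)]] u(2) by (metis Int_commute)
    have "u \<in> f_finite (X \<^bold>\<inter> check W)" if "W \<in> H" for W
      by (rule regularD_mono[OF regular_finite fin u(1)]) (use that H(2) in blast)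
    then have "\<exists>w. (w, u) \<in> r \<and> (\<forall>W\<in>H. finite (poss (X \<^bold>\<inter> check W) w))"
      by (rule ex_finite_poss_family[OF H(1) FieldI1[OF u(1)]])
    then obtain w where w: "(w, u) \<in> r" "\<And>W. W \<in> H \<Longrightarrow> finite (poss X w \<inter> W)"
      unfolding poss_inter_check by blast
    have "finite (poss X w)"
    proof (rule finite_if_finite_Int_cover[OF H(1)])
      show "finite (poss X w - \<Union>H)"
        using Diff_mono[OF poss_mono[OF w(1)] subset_refl] H(3) by (rule finite_subset)
    qed (rule w(2))
    then show False using inf le_trans[OF w(1) u(1)] unfolding forces_infinite by blast
  qed
  have "p \<in> (f_ad_family \<G> \<^bold>\<and> (\<^bold>\<forall>X. X \<^bold>\<in>\<^bold>\<in> check_fam F \<^bold>\<longrightarrow> X \<^bold>\<in>\<^bold>\<in> \<G>) \<^bold>\<longrightarrow>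
        (\<^bold>\<forall>X. X \<^bold>\<in>\<^bold>\<in> \<G> \<^bold>\<longleftrightarrow> X \<^bold>\<in>\<^bold>\<in> check_fam F))" for \<G>
  proof -
    have "q \<in> (\<^bold>\<forall>X. X \<^bold>\<in>\<^bold>\<in> \<G> \<^bold>\<longleftrightarrow> X \<^bold>\<in>\<^bold>\<in> check_fam F)"
      if "q \<in> f_ad_family \<G>" "q \<in> (\<^bold>\<forall>X. X \<^bold>\<in>\<^bold>\<in> check_fam F \<^bold>\<longrightarrow> X \<^bold>\<in>\<^bold>\<in> \<G>)" for q
    proof -
      have FG: "\<And>s X. (s, q) \<in> r \<Longrightarrow> s \<in> (X \<^bold>\<in>\<^bold>\<in> check_fam F) \<Longrightarrow> s \<in> (X \<^bold>\<in>\<^bold>\<in> \<G>)"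
        using that(2) unfolding forces_all by (simp add: forces_imp)
      have "q \<in> Field r" using that(1) by (rule regularD_Field[OF regular_ad_family])
      then show ?thesis
        unfolding forces_all using FG max[OF that(1) FG] by (auto simp: forces_iff)
    qed
    then show ?thesis using p by (simp add: forces_imp forces_and)
  qed
  then show ?thesis
    unfolding f_mad_family_def forces_and using p ex forces_ad_family_check_fam[OF ad p]
    by (simp add: forces_all)
qed

end

section \<open>Cohen forcing\<close>

lemma Field_Cohen: "Field Cohen = {q. finite (dom q)}"
proof -
  have "(q, q) \<in> Cohen" if "finite (dom q)" for q :: "nat \<rightharpoonup> bool" using that unfolding Fn_def by simp
  moreover have "finite (dom q) \<and> finite (dom p)" if "(q, p) \<in> Cohen" for q p :: "nat \<rightharpoonup> bool"
    using that finite_subset[OF map_le_implies_dom_le] unfolding Fn_def by auto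
  ultimately show ?thesis unfolding Field_def by blast
qed

lemma forcing_preorder_Cohen: "forcing_preorder Cohen"
proof
  show "(p, p) \<in> Cohen" if "p \<in> Field Cohen" for p
    using that unfolding Field_Cohen by (simp add: Fn_def)
  show "(p, s) \<in> Cohen" if "(p, q) \<in> Cohen" "(q, s) \<in> Cohen" for p q s
    using that map_le_trans unfolding Fn_def by blast
qed

text \<open>A finite partial function is determined by its graph, a finite subset of a countable
  set.\<close>

lemma countable_Field_Cohen: "countable (Field Cohen)"
proof -
  have "inj (Map.graph :: (nat \<rightharpoonup> bool) \<Rightarrow> _)"
  proof (rule injI)
    fix p q :: "nat \<rightharpoonup> bool" assume "Map.graph p = Map.graph q"
    then have "p x = Some y \<longleftrightarrow> q x = Some y" for x y by (metis in_graphD in_graphI)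
    then show "p = q" by (metis not_None_eq ext)
  qed
  moreover have "Map.graph ` Field Cohen \<subseteq> Collect finite"
    unfolding Field_Cohen by auto
  ultimately show ?thesis
    using countable_Collect_finite countable_subset countable_image_inj_on inj_on_subset by (metis subset_UNIV)
qed

theorem theorem6p5:
  assumes "continuum \<lesssim> (UNIV :: 'u set)"
    and "MA_sigma_centered TYPE('u)"
  shows "\<exists>F :: node set set.
    mad_family F \<and> F \<approx> continuum \<and>
    forcing.indestructible Cohen F \<and>
    forcing.forced Cohen (forcing.f_almost_decided Cohen continuum F)"
proof -
  interpret forcing_preorder Cohen by (rule forcing_preorder_Cohen)
  obtain F :: "node set set" where F: "ad_family F" "\<Union>F = UNIV" "F \<approx> continuum"
    and core: "\<And>A :: nat \<Rightarrow> node set. \<exists>S. S \<prec> continuum \<and> (\<forall>X\<in>F - S. \<forall>n.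
      infinite (X \<inter> A n) \<or> (\<exists>H. finite H \<and> H \<subseteq> F \<and> finite (A n - \<Union>H)))"
    using MA_ad_family_exists[OF assms infinite_UNIV_listI] by blast
  \<comment> \<open>Enumerating the countable forcing arranges the sets \<open>poss Y p\<close> in
    one sequence, so \<open>core\<close> gives a single exceptional set for all
    \<open>p\<close>.\<close>
  have dich: "\<exists>S. S \<prec> continuum \<and> (\<forall>X\<in>F - S. \<forall>p\<in>Field Cohen.
      infinite (X \<inter> poss Y p) \<or> (\<exists>H. finite H \<and> H \<subseteq> F \<and> finite (poss Y p - \<Union>H)))" for Y
  proof -
    let ?e = "from_nat_into (Field Cohen)"
    have e: "?e (to_nat_on (Field Cohen) p) = p" if "p \<in> Field Cohen" for p
      using from_nat_into_to_nat_on[OF countable_Field_Cohen that] .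
    obtain S where "S \<prec> continuum" and S: "\<And>X n. X \<in> F - S \<Longrightarrow>
        infinite (X \<inter> poss Y (?e n)) \<or> (\<exists>H. finite H \<and> H \<subseteq> F \<and> finite (poss Y (?e n) - \<Union>H))"
      using core[of "\<lambda>n. poss Y (?e n)"] by blast
    have "infinite (X \<inter> poss Y p) \<or> (\<exists>H. finite H \<and> H \<subseteq> F \<and> finite (poss Y p - \<Union>H))"
      if "X \<in> F - S" "p \<in> Field Cohen" for X p
      using S[OF that(1), of "to_nat_on (Field Cohen) p"] unfolding e[OF that(2)] .
    with \<open>S \<prec> continuum\<close> show ?thesis by blast
  qed
  \<comment> \<open>Maximality in the ground model comes from \<open>core\<close> for a constant
    sequence: a new set \<open>X\<close> almost disjoint from all of \<open>F\<close> would be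
    almost covered by finitely many members, hence finite.\<close>
  have "mad_family F"
    unfolding mad_family_def
  proof (intro conjI allI impI F(1,2))
    fix G assume G: "ad_family G \<and> F \<subseteq> G"
    have "X \<in> F" if X: "X \<in> G" for X
    proof (rule ccontr)
      assume "X \<notin> F"
      then have fin: "finite (X \<inter> Z)" if "Z \<in> F" for Z
        using G X that by (intro ad_familyD(2)[of G]) auto
      obtain S where S: "S \<prec> continuum" "\<And>Z. Z \<in> F - S \<Longrightarrow>
          infinite (Z \<inter> X) \<or> (\<exists>H. finite H \<and> H \<subseteq> F \<and> finite (X - \<Union>H))"
        using core[of "\<lambda>_. X"] by blast
      obtain Z where "Z \<in> F - S" using eqpoll_lesspoll_ex_Diff[OF F(3) S(1)] .
      then obtain H where H: "finite H" "H \<subseteq> F" "finite (X - \<Union>H)"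
        using S(2)[of Z] fin[of Z] by (metis DiffD1 Int_commute)
      then have "finite X" using fin by (intro finite_if_finite_Int_cover[of H X]) blast+
      then show False using G X ad_familyD(1) by blast
    qed
    then show "G = F" using G by blast
  qed
  moreover have "indestructible F"
    unfolding indestructible_def forced_def
    using forces_mad_family_check_fam[OF F dich] by blast
  moreover have "forced (f_almost_decided continuum F)"
    unfolding forced_def using forces_almost_decided[OF countable_Field_Cohen F(1) dich] by blast
  ultimately show ?thesis using F(3) by blast
qed

end
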